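(* Let $\gamma>0$ and let $X_1,X_2,\dots$ be i.i.d. nonnegative random variables with distribution function $F$ whose quantile function $U(t)=F^{\leftarrow}(1-1/t)$, $t\ge1$, satisfies $\lim_{t\to\infty}U(tx)/U(t)=x^{\gamma}$ for all $x>0$. Let $r\in\mathbb{R}$ with $\gamma r<1$, and let $k=k(n)$ be integers with $k(n)\to\infty$ and $n/k(n)\to\infty$. For $\ell=1,2,3$ let $$B_n^{(\ell)}(k,r)=\lim_{x\to\infty}\Big(\hat\gamma^{(\ell)}_n(k,r;X_1,\dots,X_{n-1},x)-\hat\gamma^{(\ell)}_{n-1}(k-1,r;X_1,\dots,X_{n-1})\Big),$$ and let $B^{(\ell)}=B^{(\ell)}(\gamma,r)$ denote the limit in probability of $B_n^{(\ell)}(k,r)$ as $n\to\infty$. Then for $j=1,2,3$, $$B^{(j)}=\begin{cases}0,& r<0,\\ \infty,& r=0,\\ (1-\gamma r)/r,& 0<r<1/\gamma.\end{cases}$$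
   Context: For a monotone function $W$, $W^{\leftarrow}(t)=\sup\{x: W(x)\le t\}$. For a sample $y_1,\dots,y_m$ with order statistics $y_{m,1}\le\dots\le y_{m,m}$ and $1\le k<m$, set $g_{r,u}(x)=x^r(\ln x)^u$ ($x\ge1$) and $G_m(k,r,u;y_1,\dots,y_m)=\frac1k\sum_{i=0}^{k-1}g_{r,u}(y_{m-i,m}/y_{m-k,m})$ (abbreviated $G$ below). The estimators evaluated on this sample are $$\hat\gamma^{(1)}_m(k,r;y_1,\dots,y_m)=\begin{cases}\dfrac{G_m(k,r,0)-1}{rG_m(k,r,0)},& r\ne0,\\ G_m(k,0,1),& r=0,\end{cases}\qquad \hat\gamma^{(2)}_m(k,r;y_1,\dots,y_m)=\frac{2G_m(k,r,1)}{2rG_m(k,r,1)+1+\sqrt{4rG_m(k,r,1)+1}},$$ $$\hat\gamma^{(3)}_m(k,r;y_1,\dots,y_m)=\begin{cases}\dfrac{rG_m(k,r,1)-G_m(k,r,0)+1}{r^2G_m(k,r,1)},& r\ne0,\\ \dfrac{G_m(k,0,2)}{2G_m(k,0,1)},& r=0.\end{cases}$$ *)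

theory Defs
  imports "HOL-Probability.Probability"
begin

definition gen_inv :: "(real \<Rightarrow> real) \<Rightarrow> real \<Rightarrow> real" where
  "gen_inv W t = Sup {x. W x \<le> t}"

definition ord_stat :: "real list \<Rightarrow> nat \<Rightarrow> real" where
  "ord_stat ys i = sort ys ! (i - 1)"

definition g_fun :: "real \<Rightarrow> nat \<Rightarrow> real \<Rightarrow> real" where
  "g_fun r u x = x powr r * (ln x) ^ u"

definition G_stat :: "nat \<Rightarrow> real \<Rightarrow> nat \<Rightarrow> real list \<Rightarrow> real" where
  "G_stat k r u ys = (let m = length ys in
     (1 / real k) * (\<Sum>i<k. g_fun r u (ord_stat ys (m - i) / ord_stat ys (m - k))))"

definition gamma_hat1 :: "nat \<Rightarrow> real \<Rightarrow> real list \<Rightarrow> real" where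
  "gamma_hat1 k r ys = (if r \<noteq> 0 then (G_stat k r 0 ys - 1) / (r * G_stat k r 0 ys)
                        else G_stat k 0 1 ys)"

definition gamma_hat2 :: "nat \<Rightarrow> real \<Rightarrow> real list \<Rightarrow> real" where
  "gamma_hat2 k r ys = 2 * G_stat k r 1 ys /
      (2 * r * G_stat k r 1 ys + 1 + sqrt (4 * r * G_stat k r 1 ys + 1))"

definition gamma_hat3 :: "nat \<Rightarrow> real \<Rightarrow> real list \<Rightarrow> real" where
  "gamma_hat3 k r ys = (if r \<noteq> 0
      then (r * G_stat k r 1 ys - G_stat k r 0 ys + 1) / (r\<^sup>2 * G_stat k r 1 ys)
      else G_stat k 0 2 ys / (2 * G_stat k 0 1 ys))"

definition gamma_hat :: "nat \<Rightarrow> nat \<Rightarrow> real \<Rightarrow> real list \<Rightarrow> real" where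
  "gamma_hat l k r ys = (if l = 1 then gamma_hat1 k r ys
                         else if l = 2 then gamma_hat2 k r ys else gamma_hat3 k r ys)"

text \<open>The difference inside B_n^{(l)}(k,r), as a function of the outcome \<omega> and the added
  point x: sample X_1..X_{n-1} (represented by X 0, ..., X (n-2)) plus x.\<close>
definition B_diff :: "nat \<Rightarrow> (nat \<Rightarrow> 'a \<Rightarrow> real) \<Rightarrow> nat \<Rightarrow> nat \<Rightarrow> real \<Rightarrow> 'a \<Rightarrow> real \<Rightarrow> real" where
  "B_diff l X n k r \<omega> x =
     gamma_hat l k r (map (\<lambda>i. X i \<omega>) [0..<n - 1] @ [x])
     - gamma_hat l (k - 1) r (map (\<lambda>i. X i \<omega>) [0..<n - 1])"

text \<open>"B_n := lim_{x\<rightarrow>\<infinity>} D n \<omega> x converges in probability to L" (L possibly infinite):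
  for every (ereal-)neighbourhood S of L there are events A n with probability tending to 1
  on which the limit in x exists (in the extended reals) and lies in S.\<close>
definition xlim_conv_in_prob ::
    "'a measure \<Rightarrow> (nat \<Rightarrow> 'a \<Rightarrow> real \<Rightarrow> real) \<Rightarrow> ereal \<Rightarrow> bool" where
  "xlim_conv_in_prob M D L \<longleftrightarrow>
     (\<forall>S. open S \<and> L \<in> S \<longrightarrow>
        (\<exists>A. (\<forall>n. A n \<in> sets M) \<and> (\<lambda>n. measure M (A n)) \<longlonglongrightarrow> 1 \<and>
             (\<forall>n. \<forall>\<omega>\<in>A n. \<exists>l\<in>S. ((\<lambda>x. ereal (D n \<omega> x)) \<longlongrightarrow> l) at_top)))"

end

theory Submission
  imports Defs "HOL-Real_Asymp.Real_Asymp"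
begin

text \<open>
  If the added point \<open>x\<close> exceeds the whole sample, then
  \<open>G_n(k,r,u) = (k-1)/k G_{n-1}(k-1,r,u) + g_{r,u}(x/Z)/k\<close>, where \<open>Z\<close> is the \<open>k\<close>-th largest of
  \<open>X_1, \<dots>, X_{n-1}\<close>; so the limit \<open>x \<rightarrow> \<infinity>\<close> is elementary once \<open>G_{n-1}(k-1,r,0)\<close> and
  \<open>G_{n-1}(k-1,r,1)\<close> are known to converge in probability to \<open>1/(1-\<gamma>r)\<close> and \<open>\<gamma>/(1-\<gamma>r)^2\<close>.

  For the first moment, let \<open>b = U(m/k)\<close> be the deterministic counterpart of \<open>Z\<close> (for a sample of
  size \<open>m\<close> with \<open>k\<close> upper order statistics) and let
  \<open>N(y)\<close> count the sample points above \<open>y b\<close>. Regular variation of \<open>U\<close> and a variance bound give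
  \<open>N(y)/k \<rightarrow> y^(-1/\<gamma>)\<close> in \<open>L^1\<close>. On the grid \<open>y q^j\<close> the sum \<open>\<Sum>j q^(rj) N(y q^j)/k\<close> converges in
  \<open>L^1\<close> by dominated convergence, and multiples of such sums enclose \<open>G - 1\<close>; let \<open>q\<close> decrease
  to 1. Only first moments of the summands are used, so all of \<open>\<gamma>r < 1\<close> is covered.
  The log-moment follows by differentiating in \<open>r\<close>, using convexity of \<open>r \<mapsto> x^r\<close>.
\<close>

section \<open>Convergence in probability as a filter\<close>

text \<open>A filter on pairs \<open>(n, \<omega>)\<close> turns limits in probability into ordinary
  \<open>tendsto\<close> statements, so sums, quotients and order arguments come from the general
  limit calculus. A property only has to contain suitable measurable events, exactly as in
  \<open>xlim_conv_in_prob\<close>.\<close>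

definition whp :: "'a measure \<Rightarrow> (nat \<times> 'a) filter" where
  "whp M = Abs_filter (\<lambda>P. \<exists>A. (\<forall>n. A n \<in> sets M) \<and> (\<lambda>n. measure M (A n)) \<longlonglongrightarrow> 1 \<and>
     (\<forall>n. \<forall>\<omega>\<in>A n. P (n, \<omega>)))"

context prob_space
begin

lemma prob_inter_tendsto_1:
  assumes A: "\<And>n::nat. A n \<in> events" "(\<lambda>n. prob (A n)) \<longlonglongrightarrow> 1"
    and B: "\<And>n. B n \<in> events" "(\<lambda>n. prob (B n)) \<longlonglongrightarrow> 1"
  shows "(\<lambda>n. prob (A n \<inter> B n)) \<longlonglongrightarrow> 1"
proof (rule tendsto_sandwich)
  show "\<forall>\<^sub>F n in sequentially. prob (A n) + prob (B n) - 1 \<le> prob (A n \<inter> B n)"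
  proof (intro always_eventually allI)
    fix n
    have "prob (A n \<union> B n) = prob (A n) + prob (B n) - prob (A n \<inter> B n)"
      by (rule measure_Un3) (use A B in \<open>auto simp: fmeasurable_eq_sets\<close>)
    moreover have "prob (A n \<union> B n) \<le> 1" by simp
    ultimately show "prob (A n) + prob (B n) - 1 \<le> prob (A n \<inter> B n)" by linarith
  qed
  show "(\<lambda>n. prob (A n) + prob (B n) - 1) \<longlonglongrightarrow> 1"
    using tendsto_diff[OF tendsto_add[OF A(2) B(2)] tendsto_const[of 1]] by simp
qed auto

lemma eventually_whp:
  "eventually P (whp M) \<longleftrightarrow> (\<exists>A. (\<forall>n. A n \<in> events) \<and> (\<lambda>n. prob (A n)) \<longlonglongrightarrow> 1 \<and>
     (\<forall>n. \<forall>\<omega>\<in>A n. P (n, \<omega>)))"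
  unfolding whp_def
proof (rule eventually_Abs_filter, rule is_filter.intro)
  show "\<exists>A. (\<forall>n::nat. A n \<in> events) \<and> (\<lambda>n. prob (A n)) \<longlonglongrightarrow> 1 \<and> (\<forall>n. \<forall>\<omega>\<in>A n. True)"
    by (intro exI[of _ "\<lambda>_. space M"]) (simp add: prob_space)
next
  fix P Q :: "nat \<times> 'a \<Rightarrow> bool"
  assume "\<exists>A. (\<forall>n. A n \<in> events) \<and> (\<lambda>n. prob (A n)) \<longlonglongrightarrow> 1 \<and> (\<forall>n. \<forall>\<omega>\<in>A n. P (n, \<omega>))"
    and "\<exists>A. (\<forall>n. A n \<in> events) \<and> (\<lambda>n. prob (A n)) \<longlonglongrightarrow> 1 \<and> (\<forall>n. \<forall>\<omega>\<in>A n. Q (n, \<omega>))"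
  then obtain A B where
    "\<And>n. A n \<in> events" "(\<lambda>n. prob (A n)) \<longlonglongrightarrow> 1" "\<And>n \<omega>. \<omega> \<in> A n \<Longrightarrow> P (n, \<omega>)"
    "\<And>n. B n \<in> events" "(\<lambda>n. prob (B n)) \<longlonglongrightarrow> 1" "\<And>n \<omega>. \<omega> \<in> B n \<Longrightarrow> Q (n, \<omega>)"
    by blast
  then show "\<exists>A. (\<forall>n. A n \<in> events) \<and> (\<lambda>n. prob (A n)) \<longlonglongrightarrow> 1 \<and>
      (\<forall>n. \<forall>\<omega>\<in>A n. P (n, \<omega>) \<and> Q (n, \<omega>))"
    by (intro exI[of _ "\<lambda>n. A n \<inter> B n"]) (auto intro: prob_inter_tendsto_1)
next
  fix P Q :: "nat \<times> 'a \<Rightarrow> bool"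
  assume "\<forall>x. P x \<longrightarrow> Q x"
    and "\<exists>A. (\<forall>n. A n \<in> events) \<and> (\<lambda>n. prob (A n)) \<longlonglongrightarrow> 1 \<and> (\<forall>n. \<forall>\<omega>\<in>A n. P (n, \<omega>))"
  then show "\<exists>A. (\<forall>n. A n \<in> events) \<and> (\<lambda>n. prob (A n)) \<longlonglongrightarrow> 1 \<and> (\<forall>n. \<forall>\<omega>\<in>A n. Q (n, \<omega>))"
    by blast
qed

text \<open>Transfers deterministic facts valid for large \<open>n\<close> to \<open>whp M\<close>:
  the witnessing event is the whole space for good \<open>n\<close> and empty otherwise.\<close>

lemma filterlim_fst_whp: "filterlim fst sequentially (whp M)"
  unfolding filterlim_iff
proof (intro allI impI)
  fix P :: "nat \<Rightarrow> bool" assume P: "eventually P sequentially"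
  have "(\<lambda>n. prob (if P n then space M else {})) \<longlonglongrightarrow> 1"
    by (rule tendsto_eventually, use P in eventually_elim) (simp add: prob_space)
  then show "eventually (\<lambda>p. P (fst p)) (whp M)"
    unfolding eventually_whp
    by (intro exI[of _ "\<lambda>n. if P n then space M else {}"]) (auto split: if_splits)
qed

text \<open>Markov's inequality.\<close>

lemma tendsto_whp_of_L1:
  fixes f :: "nat \<Rightarrow> 'a \<Rightarrow> real"
  assumes ev: "eventually (\<lambda>n. integrable M (f n) \<and> (\<forall>\<omega>\<in>space M. f n \<omega> \<ge> 0)) sequentially"
    and lim: "(\<lambda>n. expectation (f n)) \<longlonglongrightarrow> 0"
  shows "((\<lambda>p. f (fst p) (snd p)) \<longlongrightarrow> 0) (whp M)"
proof (rule tendstoI)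
  fix e :: real assume e: "e > 0"
  define good where "good n \<longleftrightarrow> integrable M (f n) \<and> (\<forall>\<omega>\<in>space M. f n \<omega> \<ge> 0)" for n
  \<comment> \<open>Integrability is known only for large \<open>n\<close>; the empty set keeps the
    remaining finitely many events measurable.\<close>
  define A where "A n = (if good n then {\<omega>\<in>space M. f n \<omega> < e} else {})" for n
  have A: "A n \<in> events" for n
    unfolding A_def good_def by auto
  have ev': "eventually good sequentially" using ev by (simp add: good_def[abs_def])
  have "(\<lambda>n. prob (A n)) \<longlonglongrightarrow> 1"
  proof (rule tendsto_sandwich)
    show "(\<lambda>n. 1 - expectation (f n) / e) \<longlonglongrightarrow> 1"
      using tendsto_diff[OF tendsto_const[of 1] tendsto_divide[OF lim tendsto_const[of e]]] e by simp
    show "\<forall>\<^sub>F n in sequentially. 1 - expectation (f n) / e \<le> prob (A n)"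
      using ev'
    proof eventually_elim
      case (elim n)
      then have int: "integrable M (f n)" and nn: "\<forall>\<omega>\<in>space M. f n \<omega> \<ge> 0"
        by (auto simp: good_def)
      have m[measurable]: "f n \<in> borel_measurable M" using int by auto
      have "prob {\<omega>\<in>space M. f n \<omega> \<ge> e} \<le> expectation (f n) / e"
        by (rule integral_Markov_inequality_measure[where A="{}"]) (use int nn e in auto)
      moreover have "A n = space M - {\<omega>\<in>space M. f n \<omega> \<ge> e}"
        using elim by (auto simp: A_def)
      then have "prob (A n) = 1 - prob {\<omega>\<in>space M. f n \<omega> \<ge> e}"
        by (simp add: prob_compl)
      ultimately show ?case by linarith
    qed
  qed auto
  then show "\<forall>\<^sub>F p in whp M. dist (f (fst p) (snd p)) 0 < e"
    unfolding eventually_whp using A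
    by (intro exI[of _ A]) (auto simp: A_def good_def split: if_splits)
qed

lemma xlim_conv_in_probI:
  assumes L: "(l \<longlongrightarrow> L) (whp M)"
    and ev: "eventually (\<lambda>p. ((\<lambda>x. ereal (D (fst p) (snd p) x)) \<longlongrightarrow> l p) at_top) (whp M)"
  shows "xlim_conv_in_prob M D L"
  unfolding xlim_conv_in_prob_def
proof (intro allI impI)
  fix S assume "open S \<and> L \<in> S"
  then have "eventually (\<lambda>p. l p \<in> S) (whp M)"
    using topological_tendstoD[OF L] by blast
  then have "eventually (\<lambda>p. \<exists>l\<in>S. ((\<lambda>x. ereal (D (fst p) (snd p) x)) \<longlongrightarrow> l) at_top) (whp M)"
    using ev by eventually_elim blast
  then show "\<exists>A. (\<forall>n. A n \<in> events) \<and> (\<lambda>n. prob (A n)) \<longlonglongrightarrow> 1 \<and>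
      (\<forall>n. \<forall>\<omega>\<in>A n. \<exists>l\<in>S. ((\<lambda>x. ereal (D n \<omega> x)) \<longlongrightarrow> l) at_top)"
    by (simp add: eventually_whp)
qed

section \<open>Second moments of sums of independent indicators\<close>

lemma expectation_abs_le_sqrt:
  fixes Y :: "'a \<Rightarrow> real"
  assumes [measurable]: "random_variable borel Y" and "integrable M (\<lambda>x. (Y x)\<^sup>2)"
  shows "expectation (\<lambda>x. \<bar>Y x\<bar>) \<le> sqrt (expectation (\<lambda>x. (Y x)\<^sup>2))"
proof -
  have "integrable M Y"
    by (rule square_integrable_imp_integrable) (use assms in auto)
  then have "variance (\<lambda>x. \<bar>Y x\<bar>) = expectation (\<lambda>x. \<bar>Y x\<bar>\<^sup>2) - (expectation (\<lambda>x. \<bar>Y x\<bar>))\<^sup>2"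
    by (intro variance_eq) (use assms in auto)
  then have "(expectation (\<lambda>x. \<bar>Y x\<bar>))\<^sup>2 \<le> expectation (\<lambda>x. (Y x)\<^sup>2)"
    using variance_positive[of "\<lambda>x. \<bar>Y x\<bar>"] by simp
  then show ?thesis by (rule real_le_rsqrt)
qed

text \<open>Centred indicators are pairwise orthogonal by independence, so only the diagonal of the
  expanded square survives, and each diagonal entry equals \<open>p - p * p\<close>.\<close>

lemma variance_sum_indep_indicators_le:
  fixes X :: "nat \<Rightarrow> 'a \<Rightarrow> real"
  assumes indep: "indep_vars (\<lambda>_. borel) X UNIV" and S[measurable]: "S \<in> sets borel"
    and p: "\<And>i. prob {\<omega>\<in>space M. X i \<omega> \<in> S} = p"
  defines "N \<equiv> \<lambda>m \<omega>. \<Sum>i<m. indicator S (X i \<omega>) :: real"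
  shows "expectation (N m) = real m * p" "variance (N m) \<le> real m * p"
proof -
  have rv[measurable]: "random_variable borel (X i)" for i
    using indep by (auto simp: indep_vars_def)
  define c where "c i \<omega> = indicator S (X i \<omega>) - p" for i \<omega>
  have cm[measurable]: "random_variable borel (c i)" for i unfolding c_def by measurable
  have Ei: "expectation (\<lambda>\<omega>. indicator S (X i \<omega>) :: real) = p" for i
  proof -
    have "expectation (\<lambda>\<omega>. indicator S (X i \<omega>) :: real) = expectation (indicator {\<omega>\<in>space M. X i \<omega> \<in> S})"
      by (rule Bochner_Integration.integral_cong) (auto simp: indicator_def)
    then show ?thesis using p by simp
  qed
  have int_i: "integrable M (\<lambda>\<omega>. indicator S (X i \<omega>) :: real)" for i
    by (rule integrable_const_bound[of _ 1]) (auto simp: indicator_def)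
  show EN: "expectation (N m) = real m * p"
    unfolding N_def using int_i by (simp add: Ei)
  have p01: "0 \<le> p" "p \<le> 1" using p[of 0] by (auto simp: measure_nonneg)
  have int_c: "integrable M (c i)" for i unfolding c_def using int_i by auto
  have int_cc: "integrable M (\<lambda>\<omega>. c i \<omega> * c j \<omega>)" for i j
    by (rule integrable_const_bound[of _ 1])
       (use p01 in \<open>auto simp: c_def indicator_def abs_mult intro!: mult_le_one\<close>)
  have Ec: "expectation (c i) = 0" for i
    unfolding c_def using int_i Ei by (simp add: prob_space)
  have indc: "indep_vars (\<lambda>_. borel) c UNIV"
    using indep_vars_compose2[OF indep, of "\<lambda>_ x. indicator S x - p" "\<lambda>_. borel"]
    by (simp add: c_def[abs_def])
  have off: "expectation (\<lambda>\<omega>. c i \<omega> * c j \<omega>) = 0" if "i \<noteq> j" for i j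
  proof -
    have "indep_vars (\<lambda>_. borel) c {i, j}"
      by (rule indep_vars_subset[OF indc]) simp
    then have "expectation (\<lambda>\<omega>. \<Prod>l\<in>{i, j}. c l \<omega>) = (\<Prod>l\<in>{i, j}. expectation (c l))"
      by (intro indep_vars_lebesgue_integral) (auto simp: int_c)
    then show ?thesis using that Ec by simp
  qed
  have diag: "expectation (\<lambda>\<omega>. c i \<omega> * c i \<omega>) \<le> p" for i
  proof -
    have "c i \<omega> * c i \<omega> = (1 - 2 * p) * indicator S (X i \<omega>) + p * p" for \<omega>
      by (simp add: c_def indicator_def algebra_simps)
    then have "expectation (\<lambda>\<omega>. c i \<omega> * c i \<omega>) = (1 - 2 * p) * p + p * p"
      using int_i by (simp add: Ei prob_space)
    then have "expectation (\<lambda>\<omega>. c i \<omega> * c i \<omega>) = p - p * p" by (simp add: algebra_simps)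
    moreover have "p * p \<ge> 0" by simp
    ultimately show ?thesis by linarith
  qed
  have "(N m \<omega> - expectation (N m))\<^sup>2 = (\<Sum>i<m. \<Sum>j<m. c i \<omega> * c j \<omega>)" for \<omega>
  proof -
    have "N m \<omega> - expectation (N m) = (\<Sum>i<m. c i \<omega>)"
      unfolding EN by (simp add: N_def c_def sum_subtractf)
    then show ?thesis by (simp add: power2_eq_square sum_product)
  qed
  then have "variance (N m) = (\<Sum>i<m. \<Sum>j<m. expectation (\<lambda>\<omega>. c i \<omega> * c j \<omega>))"
    using int_cc by simp
  also have "\<dots> = (\<Sum>i<m. \<Sum>j<m. if j = i then expectation (\<lambda>\<omega>. c i \<omega> * c i \<omega>) else 0)"
    by (intro sum.cong refl) (auto simp: off)
  also have "\<dots> = (\<Sum>i<m. expectation (\<lambda>\<omega>. c i \<omega> * c i \<omega>))" by simp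
  also have "\<dots> \<le> (\<Sum>i<m. p)" by (intro sum_mono diag)
  finally show "variance (N m) \<le> real m * p" by simp
qed

end

section \<open>Tails of distributions with regularly varying quantiles\<close>

locale regvar_quantile =
  fixes F :: "real \<Rightarrow> real" and \<gamma> :: real
  assumes mono_F: "mono F" and F_neg: "\<And>x. x < 0 \<Longrightarrow> F x = 0"
    and F_lim: "(F \<longlongrightarrow> 1) at_top" and \<gamma>_pos: "\<gamma> > 0"
    and regvar: "\<And>x. x > 0 \<Longrightarrow>
      ((\<lambda>t. gen_inv F (1 - 1 / (t * x)) / gen_inv F (1 - 1 / t)) \<longlongrightarrow> x powr \<gamma>) at_top"
begin

definition U :: "real \<Rightarrow> real" where "U t = gen_inv F (1 - 1 / t)"

definition T :: "real \<Rightarrow> real" where "T x = 1 - F x"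

text \<open>A real \<open>Sup\<close> is informative only for a nonempty set bounded above. The
  point -1 belongs to the set because \<open>F\<close> vanishes on the negatives, and
  \<open>F\<close> tending to 1 bounds the set because \<open>1 - 1 / t\<close> is below 1.\<close>

lemma U_nonempty_bdd:
  assumes "t \<ge> 1"
  shows "-1 \<in> {x. F x \<le> 1 - 1 / t}" "bdd_above {x. F x \<le> 1 - 1 / t}"
proof -
  show "-1 \<in> {x. F x \<le> 1 - 1 / t}" using assms F_neg[of "-1"] by (simp add: field_simps)
  have "eventually (\<lambda>x. F x > 1 - 1 / t) at_top"
    using assms by (intro order_tendstoD(1)[OF F_lim]) auto
  then obtain B where B: "\<And>x. x \<ge> B \<Longrightarrow> F x > 1 - 1 / t"
    by (auto simp: eventually_at_top_linorder)
  show "bdd_above {x. F x \<le> 1 - 1 / t}"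
    by (rule bdd_aboveI[of _ B]) (use B in \<open>metis mem_Collect_eq linorder_le_cases not_le\<close>)
qed

text \<open>Together with \<open>T_ge\<close> this inverts \<open>U\<close>. Since \<open>F\<close>
  may jump at \<open>U t\<close>, only points strictly to one side of \<open>U t\<close> are
  compared.\<close>

lemma T_less:
  assumes "t \<ge> 1" "x > U t"
  shows "T x < 1 / t"
proof (rule ccontr)
  assume "\<not> T x < 1 / t"
  then have "x \<in> {x. F x \<le> 1 - 1 / t}" by (simp add: T_def)
  then have "x \<le> U t"
    unfolding U_def gen_inv_def using U_nonempty_bdd[OF assms(1)] by (intro cSup_upper)
  with assms show False by simp
qed

lemma T_ge:
  assumes "t \<ge> 1" "x < U t"
  shows "1 / t \<le> T x"
proof -
  have "x < Sup {x. F x \<le> 1 - 1 / t}" using assms(2) by (simp add: U_def gen_inv_def)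
  then obtain z where "F z \<le> 1 - 1 / t" "x < z"
    using less_cSup_iff[of "{x. F x \<le> 1 - 1 / t}" x] U_nonempty_bdd[OF assms(1)] by auto
  moreover have "F x \<le> F z" using \<open>x < z\<close> by (intro monoD[OF mono_F]) simp
  ultimately show ?thesis by (simp add: T_def)
qed

lemma U_nonneg:
  assumes "t \<ge> 1"
  shows "U t \<ge> 0"
proof (rule ccontr)
  assume "\<not> U t \<ge> 0"
  \<comment> \<open>Half of a negative \<open>U t\<close> lies above \<open>U t\<close> but is still
    negative, where the tail equals 1.\<close>
  then have "T (U t / 2) < 1 / t" by (intro T_less assms) simp
  moreover have "T (U t / 2) = 1" using \<open>\<not> U t \<ge> 0\<close> by (simp add: T_def F_neg)
  ultimately show False using assms by (simp add: field_simps)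
qed

lemma U_pos: "eventually (\<lambda>t. U t > 0) at_top"
proof -
  \<comment> \<open>If \<open>U t = 0\<close>, the quotient is 0 by the convention for division, yet
    regular variation at 1 makes it tend to 1.\<close>
  have "eventually (\<lambda>t. U (t * 1) / U t > 0) at_top"
    by (rule order_tendstoD(1)[of _ "1 powr \<gamma>"]) (use regvar[of 1] in \<open>auto simp: U_def\<close>)
  then show ?thesis
    using eventually_ge_at_top[of 1]
  proof eventually_elim
    case (elim t)
    with U_nonneg[of t] show ?case by (cases "U t = 0") auto
  qed
qed

lemma F_le_1: "F x \<le> 1"
proof (rule tendsto_lowerbound[OF F_lim])
  show "eventually (\<lambda>y. F x \<le> F y) at_top"
    using eventually_ge_at_top[of x] by eventually_elim (rule monoD[OF mono_F])
qed simp

lemma T_nonneg: "T x \<ge> 0"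
  using F_le_1[of x] by (simp add: T_def)

lemma powr_inverse_less_iff:
  assumes "y > 0" "s > 0"
  shows "y < s powr \<gamma> \<longleftrightarrow> y powr (1 / \<gamma>) < s" "s powr \<gamma> < y \<longleftrightarrow> s < y powr (1 / \<gamma>)"
proof -
  have e: "(y powr (1 / \<gamma>)) powr \<gamma> = y" using assms \<gamma>_pos by (simp add: powr_powr)
  show "y < s powr \<gamma> \<longleftrightarrow> y powr (1 / \<gamma>) < s"
    using assms \<gamma>_pos e
      powr_less_mono2[of \<gamma> "y powr (1/\<gamma>)" s] powr_mono2[of \<gamma> s "y powr (1/\<gamma>)"] by force
  show "s powr \<gamma> < y \<longleftrightarrow> s < y powr (1 / \<gamma>)"
    using assms \<gamma>_pos e
      powr_less_mono2[of \<gamma> s "y powr (1/\<gamma>)"] powr_mono2[of \<gamma> "y powr (1/\<gamma>)" s] by force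
qed

text \<open>Regular variation is transferred from the quantile to the tail. A level
  \<open>1 / s\<close> lies below the limit exactly when \<open>y < s powr \<gamma>\<close>; then
  \<open>y * U t < U (t * s)\<close> for large \<open>t\<close>, and \<open>T_ge\<close> at
  \<open>t * s\<close> gives the lower bound. The upper bound is symmetric, through
  \<open>T_less\<close>.\<close>

lemma tail_tendsto:
  assumes y: "y > 0"
  shows "((\<lambda>t. t * T (y * U t)) \<longlongrightarrow> y powr (- 1 / \<gamma>)) at_top"
proof (rule order_tendstoI)
  fix a assume "a < y powr (- 1 / \<gamma>)"
  \<comment> \<open>The level \<open>a\<close> may be negative, whereas \<open>s = 1 / a'\<close>
    has to be positive.\<close>
  then obtain a' where a': "max a 0 < a'" "a' < y powr (- 1 / \<gamma>)"
    using dense[of "max a 0" "y powr (- 1 / \<gamma>)"] y by auto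
  define s where "s = 1 / a'"
  have s: "s > 0" "a' = 1 / s" using a' by (auto simp: s_def)
  have "y powr (1 / \<gamma>) < s" using a' y s by (simp add: powr_minus field_simps)
  then have "y < s powr \<gamma>" using powr_inverse_less_iff(1) y s by simp
  then have "eventually (\<lambda>t. U (t * s) / U t > y) at_top"
    using regvar[OF s(1)] by (auto simp: U_def dest: order_tendstoD)
  then show "eventually (\<lambda>t. a < t * T (y * U t)) at_top"
    using U_pos eventually_ge_at_top[of "1 / s"] eventually_ge_at_top[of 1]
  proof eventually_elim
    case (elim t)
    then have "1 / (t * s) \<le> T (y * U t)"
      using s by (intro T_ge) (auto simp: field_simps)
    then have "1 / s \<le> t * T (y * U t)" using elim s by (simp add: field_simps)
    then show ?case using a' s by simp
  qed
next
  fix a assume "y powr (- 1 / \<gamma>) < a"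
  then obtain a' where a': "y powr (- 1 / \<gamma>) < a'" "a' < a"
    using dense by blast
  have a'0: "a' > 0" using a'(1) y by (smt (verit) powr_gt_zero)
  define s where "s = 1 / a'"
  have s: "s > 0" "a' = 1 / s" using a'0 by (auto simp: s_def)
  have "s < y powr (1 / \<gamma>)" using a' y s by (simp add: powr_minus field_simps)
  then have "s powr \<gamma> < y" using powr_inverse_less_iff(2) y s by simp
  then have "eventually (\<lambda>t. U (t * s) / U t < y) at_top"
    using regvar[OF s(1)] by (auto simp: U_def dest: order_tendstoD)
  then show "eventually (\<lambda>t. t * T (y * U t) < a) at_top"
    using U_pos eventually_ge_at_top[of "1 / s"] eventually_ge_at_top[of 1]
  proof eventually_elim
    case (elim t)
    then have "T (y * U t) < 1 / (t * s)"
      using s by (intro T_less) (auto simp: field_simps)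
    then have "t * T (y * U t) < 1 / s" using elim s by (simp add: field_simps)
    then show ?case using a' s by simp
  qed
qed

text \<open>A Potter-type bound: iterating \<open>U (\<rho> t) \<le> q U t\<close> along a geometric grid.\<close>

lemma tail_geometric_bound:
  assumes q: "q > 1" and \<rho>: "1 < \<rho>" "\<rho> < q powr (1 / \<gamma>)" and y: "y > 0"
  obtains p where "eventually (\<lambda>t. \<forall>j\<ge>p. t * T (y * q ^ j * U t) \<le> \<rho> ^ p * (1 / \<rho>) ^ j) at_top"
proof -
  \<comment> \<open>Skipping \<open>p\<close> grid points makes \<open>y * q ^ p\<close> exceed 1,
    which supplies the strict inequality that \<open>T_less\<close> requires; the price is the
    factor \<open>\<rho> ^ p\<close>.\<close>
  obtain p where "inverse y < q ^ p" using real_arch_pow[OF q] by blast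
  then have p: "y * q ^ p > 1" using y by (simp add: field_simps)
  have "\<rho> powr \<gamma> < q" using powr_inverse_less_iff(2)[of q \<rho>] q \<rho> by simp
  then have "eventually (\<lambda>t. U (t * \<rho>) / U t < q) at_top"
    using regvar[of \<rho>] \<rho> by (auto simp: U_def dest: order_tendstoD)
  then have "eventually (\<lambda>t. U (t * \<rho>) / U t < q \<and> U t > 0) at_top"
    using U_pos by eventually_elim simp
  then obtain t0 where t0: "\<And>t. t \<ge> t0 \<Longrightarrow> U (t * \<rho>) / U t < q \<and> U t > 0"
    by (auto simp: eventually_at_top_linorder)
  have iter: "U (t * \<rho> ^ j) \<le> q ^ j * U t" if t: "t \<ge> max t0 1" for t j
  proof (induction j)
    case (Suc j)
    have "t * 1 \<le> t * \<rho> ^ j" using t \<rho> by (intro mult_left_mono one_le_power) auto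
    with t have "t * \<rho> ^ j \<ge> t0" by linarith
    from t0[OF this] have "U (t * \<rho> ^ j * \<rho>) \<le> q * U (t * \<rho> ^ j)"
      by (simp add: divide_less_eq less_imp_le)
    also have "\<dots> \<le> q * (q ^ j * U t)" using Suc q by (intro mult_left_mono) auto
    finally show ?case by (simp add: mult_ac)
  qed simp
  have "eventually (\<lambda>t. \<forall>j\<ge>p. t * T (y * q ^ j * U t) \<le> \<rho> ^ p * (1 / \<rho>) ^ j) at_top"
    using eventually_ge_at_top[of "max t0 1"]
  proof eventually_elim
    case (elim t)
    show ?case
    proof (intro allI impI)
      fix j assume "j \<ge> p"
      then obtain i where i: "j = p + i" by (auto simp: le_iff_add)
      have t1: "1 \<le> t * \<rho> ^ i"
        using elim \<rho> mult_mono[of 1 t 1 "\<rho> ^ i"] one_le_power[of \<rho> i] by auto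
      have "q ^ i * U t > 0" using q t0[of t] elim by simp
      then have "q ^ i * U t < (y * q ^ p) * (q ^ i * U t)"
        using mult_strict_right_mono[OF p, of "q ^ i * U t"] by (simp only: mult_1)
      then have "U (t * \<rho> ^ i) < y * q ^ j * U t"
        using iter[OF elim, of i] by (simp add: i power_add mult_ac)
      then have "T (y * q ^ j * U t) < 1 / (t * \<rho> ^ i)" by (rule T_less[OF t1])
      then have "t * T (y * q ^ j * U t) \<le> 1 / \<rho> ^ i" using elim \<rho> by (simp add: field_simps)
      then show "t * T (y * q ^ j * U t) \<le> \<rho> ^ p * (1 / \<rho>) ^ j"
        using \<rho> by (simp add: i power_add field_simps)
    qed
  qed
  then show ?thesis by (rule that)
qed

end

section \<open>Order statistics and power moments\<close>

lemma sort_append_max: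
  assumes "\<And>y. y \<in> set xs \<Longrightarrow> y \<le> x"
  shows "sort (xs @ [x]) = sort xs @ [x :: real]"
  by (rule properties_for_sort) (use assms in \<open>auto simp: sorted_append\<close>)

lemma G_stat_append_max:
  assumes k: "2 \<le> k" "k \<le> length xs" and x: "\<And>y. y \<in> set xs \<Longrightarrow> y \<le> x"
  shows "G_stat k r u (xs @ [x]) = real (k - 1) / real k * G_stat (k - 1) r u xs +
           g_fun r u (x / ord_stat xs (length xs - (k - 1))) / real k"
proof -
  define m where "m = length xs"
  define Z where "Z = ord_stat xs (m - (k - 1))"
  obtain l where l: "k = Suc l" using k by (cases k) auto
  have old: "ord_stat (xs @ [x]) i = ord_stat xs i" if "1 \<le> i" "i \<le> m" for i
    using that by (auto simp: ord_stat_def sort_append_max[OF x] nth_append m_def)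
  have new: "ord_stat (xs @ [x]) (Suc m) = x"
    by (simp add: ord_stat_def sort_append_max[OF x] nth_append m_def)
  \<comment> \<open>Adding one point and one upper order statistic leaves the threshold in place:
    \<open>Suc m - k\<close> equals \<open>m - (k - 1)\<close>. Hence \<open>x\<close> enters only
    through the top summand.\<close>
  have Z': "ord_stat (xs @ [x]) (Suc m - k) = Z"
    using k old[of "m - l"] by (simp add: Z_def l m_def)
  have "(\<Sum>i<k. g_fun r u (ord_stat (xs @ [x]) (Suc m - i) / Z)) =
      g_fun r u (x / Z) + (\<Sum>i<l. g_fun r u (ord_stat (xs @ [x]) (m - i) / Z))"
    by (simp add: l sum.lessThan_Suc_shift new del: sum.lessThan_Suc)
  also have "(\<Sum>i<l. g_fun r u (ord_stat (xs @ [x]) (m - i) / Z)) =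
      (\<Sum>i<l. g_fun r u (ord_stat xs (m - i) / Z))"
    by (intro sum.cong refl) (use k in \<open>auto simp: old l m_def\<close>)
  finally have "G_stat k r u (xs @ [x]) =
      (g_fun r u (x / Z) + (\<Sum>i<l. g_fun r u (ord_stat xs (m - i) / Z))) / real k"
    by (simp add: G_stat_def Let_def m_def[symmetric] Z')
  moreover have "(\<Sum>i<l. g_fun r u (ord_stat xs (m - i) / Z)) = real l * G_stat l r u xs"
    using k by (simp add: G_stat_def Let_def m_def[symmetric] Z_def l)
  ultimately show ?thesis
    by (simp add: l Z_def m_def add_divide_distrib)
qed

text \<open>Entries above \<open>v\<close> form a final segment of the sorted list, and exactly
  \<open>k\<close> entries follow the zero-based index \<open>m - k - 1\<close>. This converts
  bounds on exceedance counts into bounds on the random threshold.\<close>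

lemma ord_stat_greater_iff:
  assumes "k < length xs"
  shows "v < ord_stat xs (length xs - k) \<longleftrightarrow> k < length (filter (\<lambda>x. v < x) xs)"
proof -
  define ys where "ys = sort xs"
  define m where "m = length xs"
  have m: "length ys = m" "k < m" "sorted ys" using assms by (auto simp: ys_def m_def)
  have os: "ord_stat xs (length xs - k) = ys ! (m - k - 1)"
    by (simp add: ord_stat_def ys_def m_def)
  have "length (filter (\<lambda>x. v < x) xs) = length (filter (\<lambda>x. v < x) ys)"
    by (simp add: ys_def filter_sort)
  also have "\<dots> = card {i. i < m \<and> v < ys ! i}"
    by (simp add: length_filter_conv_card m)
  finally have len: "length (filter (\<lambda>x. v < x) xs) = card {i. i < m \<and> v < ys ! i}" .
  show ?thesis
  proof
    assume *: "v < ord_stat xs (length xs - k)"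
    have "{m - k - 1..<m} \<subseteq> {i. i < m \<and> v < ys ! i}"
    proof
      fix i assume "i \<in> {m - k - 1..<m}"
      then have "i < m" "ys ! (m - k - 1) \<le> ys ! i"
        using m by (auto intro!: sorted_nth_mono)
      then show "i \<in> {i. i < m \<and> v < ys ! i}" using * os by simp
    qed
    then have "card {m - k - 1..<m} \<le> card {i. i < m \<and> v < ys ! i}"
      by (intro card_mono) auto
    then show "k < length (filter (\<lambda>x. v < x) xs)" using m len by simp
  next
    assume *: "k < length (filter (\<lambda>x. v < x) xs)"
    show "v < ord_stat xs (length xs - k)"
    proof (rule ccontr)
      assume neg: "\<not> v < ord_stat xs (length xs - k)"
      have "{i. i < m \<and> v < ys ! i} \<subseteq> {m - k..<m}"
      proof
        fix i assume i: "i \<in> {i. i < m \<and> v < ys ! i}"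
        have "\<not> i \<le> m - k - 1"
        proof
          assume "i \<le> m - k - 1"
          then have "ys ! i \<le> ys ! (m - k - 1)" using m by (intro sorted_nth_mono) auto
          then show False using i neg os by simp
        qed
        then show "i \<in> {m - k..<m}" using i by auto
      qed
      then have "card {i. i < m \<and> v < ys ! i} \<le> card {m - k..<m}"
        by (intro card_mono) auto
      then show False using m len * by simp
    qed
  qed
qed

lemma ord_stat_mono:
  assumes "1 \<le> i" "i \<le> j" "j \<le> length xs"
  shows "ord_stat xs i \<le> ord_stat xs j"
  unfolding ord_stat_def by (intro sorted_nth_mono) (use assms in auto)

text \<open>Truncation at 1 makes every point at or below the threshold contribute 0. The average
  over the top \<open>k\<close> order statistics thereby becomes a sum over the unordered sample,
  which exceedance counts can control.\<close>

lemma G_stat_0_eq_sum_list: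
  assumes k: "1 \<le> k" "k < length xs" and Z: "ord_stat xs (length xs - k) > 0"
  shows "G_stat k r 0 xs - 1 =
    (\<Sum>x\<leftarrow>xs. (max (x / ord_stat xs (length xs - k)) 1) powr r - 1) / real k"
proof -
  define ys where "ys = sort xs"
  define m where "m = length xs"
  define Z where "Z = ord_stat xs (m - k)"
  define f where "f x = (max (x / Z) 1) powr r - 1" for x
  have Z0: "Z > 0" using Z by (simp add: Z_def m_def)
  have m: "length ys = m" "k < m" "sorted ys" using k by (auto simp: ys_def m_def)
  have Zy: "Z = ys ! (m - k - 1)" by (simp add: Z_def ord_stat_def ys_def)
  have "(\<Sum>x\<leftarrow>xs. f x) = (\<Sum>x\<leftarrow>ys. f x)"
    unfolding ys_def by (metis mset_map mset_sort sum_mset_sum_list)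
  also have "\<dots> = (\<Sum>i<m. f (ys ! i))"
    by (simp add: sum_list_sum_nth m atLeast0LessThan)
  also have "\<dots> = (\<Sum>i<m - k. f (ys ! i)) + (\<Sum>i\<in>{m - k..<m}. f (ys ! i))"
    by (subst sum.union_disjoint[symmetric]) (auto intro!: sum.cong)
  also have "(\<Sum>i<m - k. f (ys ! i)) = 0"
  proof (intro sum.neutral ballI)
    fix i assume "i \<in> {..<m - k}"
    then have "ys ! i \<le> Z" unfolding Zy using m by (intro sorted_nth_mono) auto
    then show "f (ys ! i) = 0" using Z0 by (simp add: f_def max_def divide_le_eq)
  qed
  also have "(\<Sum>i\<in>{m - k..<m}. f (ys ! i)) = (\<Sum>i<k. f (ys ! (m - 1 - i)))"
    by (rule sum.reindex_bij_witness[of _ "\<lambda>i. m - 1 - i" "\<lambda>i. m - 1 - i"]) (use m in auto)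
  also have "\<dots> = (\<Sum>i<k. g_fun r 0 (ord_stat xs (m - i) / Z) - 1)"
  proof (intro sum.cong refl)
    fix i assume i: "i \<in> {..<k}"
    then have "Z \<le> ys ! (m - 1 - i)" unfolding Zy using m by (intro sorted_nth_mono) auto
    then have "max (ys ! (m - 1 - i) / Z) 1 = ys ! (m - 1 - i) / Z"
      using Z0 by (simp add: max_def le_divide_eq)
    then show "f (ys ! (m - 1 - i)) = g_fun r 0 (ord_stat xs (m - i) / Z) - 1"
      by (simp add: f_def g_fun_def ord_stat_def ys_def)
  qed
  finally have "(\<Sum>x\<leftarrow>xs. f x) = (\<Sum>i<k. g_fun r 0 (ord_stat xs (m - i) / Z)) - real k"
    by (simp add: sum_subtractf)
  then show ?thesis
    using k unfolding G_stat_def Let_def m_def[symmetric] Z_def[symmetric] f_def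
    by (simp add: field_simps)
qed

section \<open>Difference-quotient bounds for the log-moment\<close>

text \<open>Both parts are \<open>ln u \<le> u - 1\<close>, taken at \<open>u = x powr d\<close> and
  \<open>u = x powr (- d)\<close> and multiplied by \<open>x powr r\<close>.\<close>

lemma powr_mult_ln_bounds:
  assumes "(x::real) > 0" "d > 0"
  shows "x powr r * ln x \<le> (x powr (r + d) - x powr r) / d"
    and "(x powr r - x powr (r - d)) / d \<le> x powr r * ln x"
proof -
  have "d * ln x \<le> x powr d - 1"
    using ln_le_minus_one[of "x powr d"] assms by (simp add: ln_powr)
  then have "x powr r * (d * ln x) \<le> x powr r * (x powr d - 1)"
    by (intro mult_left_mono) auto
  then show "x powr r * ln x \<le> (x powr (r + d) - x powr r) / d"
    using assms by (simp add: powr_add field_simps)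
  have "- d * ln x \<le> x powr (- d) - 1"
    using ln_le_minus_one[of "x powr (- d)"] assms by (simp add: ln_powr)
  then have "x powr r * (- d * ln x) \<le> x powr r * (x powr (- d) - 1)"
    by (intro mult_left_mono) auto
  moreover have "x powr r * x powr (- d) = x powr (r - d)" by (simp flip: powr_add)
  ultimately show "(x powr r - x powr (r - d)) / d \<le> x powr r * ln x"
    using assms by (simp add: field_simps)
qed

text \<open>Convexity of \<open>r \<mapsto> x powr r\<close> squeezes the first log-moment between difference quotients of
  the pure power moments.\<close>

lemma G_stat_1_bounds:
  assumes k: "1 \<le> k" "k < length xs" and Z: "ord_stat xs (length xs - k) > 0" and d: "d > 0"
  shows "G_stat k r 1 xs \<le> (G_stat k (r + d) 0 xs - G_stat k r 0 xs) / d"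
    and "(G_stat k r 0 xs - G_stat k (r - d) 0 xs) / d \<le> G_stat k r 1 xs"
proof -
  define z where "z i = ord_stat xs (length xs - i) / ord_stat xs (length xs - k)" for i
  have z: "z i > 0" if "i < k" for i
  proof -
    have "ord_stat xs (length xs - k) \<le> ord_stat xs (length xs - i)"
      using that k by (intro ord_stat_mono) auto
    then show ?thesis using Z by (simp add: z_def)
  qed
  have G: "G_stat k s u xs = (\<Sum>i<k. g_fun s u (z i)) / real k" for s u
    by (simp add: G_stat_def Let_def z_def)
  have "(\<Sum>i<k. g_fun r 1 (z i)) \<le> (\<Sum>i<k. (g_fun (r + d) 0 (z i) - g_fun r 0 (z i)) / d)"
    by (intro sum_mono) (use powr_mult_ln_bounds(1)[OF z d] in \<open>auto simp: g_fun_def\<close>)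
  from divide_right_mono[OF this, of "real k"] show "G_stat k r 1 xs \<le> (G_stat k (r + d) 0 xs - G_stat k r 0 xs) / d"
    by (simp add: G sum_divide_distrib[symmetric] sum_subtractf diff_divide_distrib mult.commute)
  have "(\<Sum>i<k. (g_fun r 0 (z i) - g_fun (r - d) 0 (z i)) / d) \<le> (\<Sum>i<k. g_fun r 1 (z i))"
    by (intro sum_mono) (use powr_mult_ln_bounds(2)[OF z d] in \<open>auto simp: g_fun_def\<close>)
  from divide_right_mono[OF this, of "real k"] show "(G_stat k r 0 xs - G_stat k (r - d) 0 xs) / d \<le> G_stat k r 1 xs"
    by (simp add: G sum_divide_distrib[symmetric] sum_subtractf diff_divide_distrib mult.commute)
qed

section \<open>Discretisation of powers on a geometric grid\<close>

text \<open>The denominator has the sign of \<open>r\<close>, so the quotient increases for either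
  sign and the grid bounds need no case distinction.\<close>

lemma powr_quotient_mono:
  assumes q: "(q::real) > 1" and r: "r \<noteq> 0" and w: "0 < v" "v \<le> w"
  shows "(v powr r - 1) / (q powr r - 1) \<le> (w powr r - 1) / (q powr r - 1)"
proof (cases "r > 0")
  case True
  then have "q powr r > 1" using q by simp
  moreover have "v powr r \<le> w powr r" using True w by (intro powr_mono2) auto
  ultimately show ?thesis by (intro divide_right_mono) auto
next
  case False
  then have "q powr r < 1" using q r powr_less_mono[of r 0 q] by simp
  moreover have "w powr r \<le> v powr r" using False w by (intro powr_mono2') auto
  ultimately show ?thesis by (intro divide_right_mono_neg) auto
qed

text \<open>Here \<open>s\<close> counts the grid points strictly below \<open>x\<close>. The grid
  is increasing and unbounded, so the series has finitely many nonzero terms and converges for every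
  ratio \<open>c\<close>.\<close>

lemma geometric_grid_sum:
  assumes q: "(q::real) > 1" and a: "a > 0"
  obtains s where "x \<le> a * q ^ s" "s = 0 \<or> a * q ^ (s - 1) < x"
    "\<And>c. (\<lambda>j. c ^ j * indicator {a * q ^ j<..} x) sums (\<Sum>j<s. c ^ j :: real)"
proof -
  obtain s0 where "x / a < q ^ s0" using real_arch_pow[OF q] by blast
  then have ex: "x \<le> a * q ^ s0" using a by (simp add: field_simps)
  define s where "s = (LEAST s. x \<le> a * q ^ s)"
  have s: "x \<le> a * q ^ s" unfolding s_def by (rule LeastI[of _ s0]) (rule ex)
  have iff: "a * q ^ j < x \<longleftrightarrow> j < s" for j
  proof
    assume "a * q ^ j < x"
    show "j < s"
    proof (rule ccontr)
      assume "\<not> j < s"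
      then have "a * q ^ s \<le> a * q ^ j" using q a by (intro mult_left_mono power_increasing) auto
      then show False using s \<open>a * q ^ j < x\<close> by simp
    qed
  next
    assume "j < s"
    then have "\<not> x \<le> a * q ^ j" unfolding s_def by (rule not_less_Least)
    then show "a * q ^ j < x" by simp
  qed
  show ?thesis
  proof (rule that[of s])
    show "s = 0 \<or> a * q ^ (s - 1) < x" by (auto simp: iff)
    show "(\<lambda>j. c ^ j * indicator {a * q ^ j<..} x) sums (\<Sum>j<s. c ^ j :: real)" for c
    proof -
      have "(\<lambda>j. c ^ j * indicator {a * q ^ j<..} x) sums
          (\<Sum>j\<in>{..<s}. c ^ j * indicator {a * q ^ j<..} x)"
        by (rule sums_finite) (auto simp: iff)
      also have "(\<Sum>j\<in>{..<s}. c ^ j * indicator {a * q ^ j<..} x) = (\<Sum>j<s. c ^ j)"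
        by (intro sum.cong refl) (auto simp: iff)
      finally show ?thesis .
    qed
  qed (rule s)
qed

lemma grid_summable:
  assumes "(q::real) > 1" "a > 0"
  shows "summable (\<lambda>j. c ^ j * indicator {a * q ^ j<..} x :: real)"
  using geometric_grid_sum[OF assms] by (metis sums_summable)

text \<open>The grid sum is the geometric sum \<open>((q ^ s) powr r - 1) / (q powr r - 1)\<close>,
  so it suffices to compare \<open>q ^ s\<close> with \<open>max (x / Z) 1\<close>.\<close>

lemma grid_sum_bounds:
  fixes q a r Z x :: real
  assumes q: "q > 1" and a: "a > 0" and r: "r \<noteq> 0" and Z: "Z > 0"
  defines "S \<equiv> \<Sum>j. (q powr r) ^ j * indicator {a * q ^ j<..} x"
  shows "a \<le> Z \<Longrightarrow> (max (x / Z) 1 powr r - 1) / (q powr r - 1) \<le> S"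
    and "q * Z \<le> a \<Longrightarrow> S \<le> (max (x / Z) 1 powr r - 1) / (q powr r - 1)"
proof -
  obtain s where s: "x \<le> a * q ^ s" "s = 0 \<or> a * q ^ (s - 1) < x"
    and sums: "(\<lambda>j. (q powr r) ^ j * indicator {a * q ^ j<..} x) sums (\<Sum>j<s. (q powr r) ^ j)"
    using geometric_grid_sum[OF q a] by metis
  have ne: "q powr r \<noteq> 1" using q r by simp
  have pw: "(q powr r) ^ s = (q ^ s) powr r"
    using q by (simp add: powr_power powr_realpow[symmetric] powr_powr mult.commute)
  have S: "S = ((q ^ s) powr r - 1) / (q powr r - 1)"
    using sums_unique[OF sums] ne by (simp add: S_def geometric_sum pw)
  show "(max (x / Z) 1 powr r - 1) / (q powr r - 1) \<le> S" if "a \<le> Z"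
  proof -
    have "a * q ^ s \<le> Z * q ^ s" using that q by (intro mult_right_mono) auto
    then have "x \<le> Z * q ^ s" using s by simp
    then have "max (x / Z) 1 \<le> q ^ s" using Z q by (simp add: field_simps)
    then show ?thesis unfolding S by (intro powr_quotient_mono q r) auto
  qed
  show "S \<le> (max (x / Z) 1 powr r - 1) / (q powr r - 1)" if "q * Z \<le> a"
  proof -
    have "q ^ s \<le> max (x / Z) 1"
    proof (cases "s = 0")
      case False
      \<comment> \<open>Only the grid point with index \<open>s - 1\<close> is known to lie below
        \<open>x\<close>; the missing factor \<open>q\<close> is paid for by
        \<open>q * Z \<le> a\<close>.\<close>
      then have "q ^ s * Z = q * Z * q ^ (s - 1)" by (cases s) auto
      also have "\<dots> \<le> a * q ^ (s - 1)" using that q by (intro mult_right_mono) auto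
      also have "\<dots> \<le> x" using s False by simp
      finally show ?thesis using Z by (simp add: le_max_iff_disj le_divide_eq)
    qed simp
    then show ?thesis unfolding S using q by (intro powr_quotient_mono q r) auto
  qed
qed

section \<open>Convergence of the moment statistics\<close>

text \<open>Sample size and number of upper order statistics are free sequences, because the moments
  are eventually taken at \<open>n - 1\<close> and \<open>k n - 1\<close>.\<close>

locale regvar_sample = prob_space M for M :: "'a measure" +
  fixes X :: "nat \<Rightarrow> 'a \<Rightarrow> real" and \<gamma> :: real and m k :: "nat \<Rightarrow> nat"
  assumes indep: "indep_vars (\<lambda>_. borel) X UNIV"
    and ident: "\<And>i. distr M borel (X i) = distr M borel (X 0)"
    and nonneg: "\<And>i \<omega>. \<omega> \<in> space M \<Longrightarrow> X i \<omega> \<ge> 0"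
    and gpos: "\<gamma> > 0"
    and U_regvar: "\<And>x. x > 0 \<Longrightarrow>
       ((\<lambda>t. gen_inv (\<lambda>y. prob {\<omega>\<in>space M. X 0 \<omega> \<le> y}) (1 - 1 / (t * x))
           / gen_inv (\<lambda>y. prob {\<omega>\<in>space M. X 0 \<omega> \<le> y}) (1 - 1 / t)) \<longlongrightarrow> x powr \<gamma>) at_top"
    and k_inf: "filterlim k at_top sequentially"
    and mk_inf: "filterlim (\<lambda>n. real (m n) / real (k n)) at_top sequentially"
begin

lemma rv[measurable]: "random_variable borel (X i)"
  using indep by (auto simp: indep_vars_def)

lemma prob_X_in: "S \<in> sets borel \<Longrightarrow> prob {\<omega>\<in>space M. X i \<omega> \<in> S} = prob {\<omega>\<in>space M. X 0 \<omega> \<in> S}"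
proof -
  assume S: "S \<in> sets borel"
  have "prob {\<omega>\<in>space M. X j \<omega> \<in> S} = measure (distr M borel (X j)) S" for j
    using S by (subst measure_distr) (auto intro!: arg_cong[where f=prob])
  then show ?thesis using ident[of i] by metis
qed

sublocale regvar_quantile "\<lambda>y. prob {\<omega>\<in>space M. X 0 \<omega> \<le> y}" \<gamma>
proof unfold_locales
  show "mono (\<lambda>y. prob {\<omega>\<in>space M. X 0 \<omega> \<le> y})"
    by (intro monoI finite_measure_mono) auto
  show "prob {\<omega>\<in>space M. X 0 \<omega> \<le> x} = 0" if "x < 0" for x
  proof -
    have "{\<omega>\<in>space M. X 0 \<omega> \<le> x} = {}" using nonneg[of _ 0] that by force
    then show ?thesis by (simp only: measure_empty)
  qed
  interpret D: real_distribution "distr M borel (X 0)" by (rule real_distribution_distr) simp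
  have "cdf (distr M borel (X 0)) = (\<lambda>y. prob {\<omega>\<in>space M. X 0 \<omega> \<le> y})"
    by (auto simp: cdf_def measure_distr intro!: ext arg_cong[where f=prob])
  with D.cdf_lim_at_top_prob show "((\<lambda>y. prob {\<omega>\<in>space M. X 0 \<omega> \<le> y}) \<longlongrightarrow> 1) at_top"
    by simp
qed (fact gpos, fact U_regvar)

definition b :: "nat \<Rightarrow> real" where "b n = U (real (m n) / real (k n))"

definition N :: "nat \<Rightarrow> real \<Rightarrow> 'a \<Rightarrow> real" where
  "N n v \<omega> = (\<Sum>i<m n. indicator {v<..} (X i \<omega>))"

definition xs :: "nat \<Rightarrow> 'a \<Rightarrow> real list" where
  "xs n \<omega> = map (\<lambda>i. X i \<omega>) [0..<m n]"

text \<open>This is the (\<open>k n\<close> + 1)-th largest sample point, the denominator of all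
  ratios in \<open>G_stat\<close>.\<close>

definition Z :: "nat \<Rightarrow> 'a \<Rightarrow> real" where
  "Z n \<omega> = ord_stat (xs n \<omega>) (m n - k n)"

lemma length_xs[simp]: "length (xs n \<omega>) = m n" by (simp add: xs_def)

lemma prob_X_greater: "prob {\<omega>\<in>space M. X i \<omega> \<in> {v<..}} = T v"
proof -
  have "{\<omega>\<in>space M. X 0 \<omega> \<in> {v<..}} = space M - {\<omega>\<in>space M. X 0 \<omega> \<le> v}" by auto
  then have "prob {\<omega>\<in>space M. X 0 \<omega> \<in> {v<..}} = T v" by (simp add: prob_compl T_def)
  then show ?thesis using prob_X_in[of "{v<..}" i] by simp
qed

lemma expectation_N: "expectation (N n v) = real (m n) * T v"
  and variance_N: "variance (N n v) \<le> real (m n) * T v"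
  using variance_sum_indep_indicators_le[OF indep _ prob_X_greater, of v "m n"]
  by (simp_all add: N_def[abs_def])

lemma N_measurable[measurable]: "random_variable borel (N n v)"
  unfolding N_def[abs_def] by measurable

lemma N_nonneg: "N n v \<omega> \<ge> 0"
  by (simp add: N_def sum_nonneg)

lemma N_le: "N n v \<omega> \<le> real (m n)"
  unfolding N_def by (rule order.trans[OF sum_bounded_above[of _ _ 1]]) (auto simp: indicator_def)

lemma integrable_N: "integrable M (N n v)"
  by (rule integrable_const_bound[of _ "real (m n)"]) (auto simp: N_nonneg N_le)

lemma integrable_N_dev: "integrable M (\<lambda>\<omega>. \<bar>N n v \<omega> / c - d\<bar>)"
  using integrable_N by auto

text \<open>A crude triangle bound that serves as the dominating term on the far part of the grid.
  It decays like the tail itself; the variance bound would decay like its square root and be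
  summable against \<open>q powr (r * j)\<close> only for
  \<open>\<gamma> * r < 1 / 2\<close>.\<close>

lemma expectation_N_dev_le:
  assumes "d \<ge> 0"
  shows "expectation (\<lambda>\<omega>. \<bar>N n v \<omega> / real (k n) - d\<bar>) \<le> real (m n) / real (k n) * T v + d"
proof -
  have "expectation (\<lambda>\<omega>. \<bar>N n v \<omega> / real (k n) - d\<bar>) \<le> expectation (\<lambda>\<omega>. N n v \<omega> / real (k n) + d)"
  proof (intro integral_mono integrable_N_dev)
    fix \<omega>
    have "N n v \<omega> / real (k n) \<ge> 0" using N_nonneg by simp
    then show "\<bar>N n v \<omega> / real (k n) - d\<bar> \<le> N n v \<omega> / real (k n) + d" using assms by simp
  qed (use integrable_N in auto)
  also have "\<dots> = real (m n) / real (k n) * T v + d"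
    using integrable_N by (simp add: expectation_N prob_space)
  finally show ?thesis .
qed

lemma eventually_k_m: "eventually (\<lambda>n. 1 \<le> k n \<and> k n < m n \<and> b n > 0) sequentially"
proof -
  have "eventually (\<lambda>n. real (m n) / real (k n) > 1) sequentially"
    using mk_inf by (simp add: filterlim_at_top_dense)
  moreover have "eventually (\<lambda>n. b n > 0) sequentially"
    unfolding b_def using mk_inf U_pos by (rule eventually_compose_filterlim[rotated])
  moreover have "eventually (\<lambda>n. k n \<ge> 1) sequentially"
    using k_inf by (simp add: filterlim_at_top)
  ultimately show ?thesis
    by eventually_elim (auto simp: field_simps)
qed

lemma tail_N_tendsto:
  assumes "y > 0"
  shows "(\<lambda>n. real (m n) / real (k n) * T (y * b n)) \<longlonglongrightarrow> y powr (- 1 / \<gamma>)"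
  unfolding b_def by (rule filterlim_compose[OF tail_tendsto[OF assms] mk_inf])

text \<open>The error splits into the deviation from the mean, of size at most
  \<open>sqrt (\<mu> n / k n)\<close> by the variance bound, and the bias
  \<open>\<bar>\<mu> n - \<theta>\<bar>\<close>.\<close>

lemma N_L1:
  assumes y: "y > 0"
  shows "(\<lambda>n. expectation (\<lambda>\<omega>. \<bar>N n (y * b n) \<omega> / real (k n) - y powr (- 1 / \<gamma>)\<bar>)) \<longlonglongrightarrow> 0"
proof -
  define \<mu> where "\<mu> n = real (m n) / real (k n) * T (y * b n)" for n
  define \<theta> where "\<theta> = y powr (- 1 / \<gamma>)"
  have \<mu>: "\<mu> \<longlonglongrightarrow> \<theta>" unfolding \<mu>_def \<theta>_def by (rule tail_N_tendsto[OF y])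
  have kr: "filterlim (\<lambda>n. real (k n)) at_top sequentially"
    using filterlim_compose[OF filterlim_real_sequentially k_inf] .
  have lim: "(\<lambda>n. sqrt (\<mu> n / real (k n)) + \<bar>\<mu> n - \<theta>\<bar>) \<longlonglongrightarrow> 0"
  proof -
    have "(\<lambda>n. sqrt (\<mu> n / real (k n)) + \<bar>\<mu> n - \<theta>\<bar>) \<longlonglongrightarrow> sqrt 0 + \<bar>\<theta> - \<theta>\<bar>"
      by (intro tendsto_intros tendsto_divide_0[OF \<mu>] filterlim_at_top_imp_at_infinity kr \<mu>)
    then show ?thesis by simp
  qed
  show ?thesis
  proof (rule tendsto_sandwich[OF _ _ tendsto_const lim])
    show "\<forall>\<^sub>F n in sequentially. expectation (\<lambda>\<omega>. \<bar>N n (y * b n) \<omega> / real (k n) - y powr (- 1 / \<gamma>)\<bar>)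
        \<le> sqrt (\<mu> n / real (k n)) + \<bar>\<mu> n - \<theta>\<bar>"
      using eventually_k_m
    proof eventually_elim
      case (elim n)
      define v where "v = y * b n"
      define K where "K = real (k n)"
      have K: "K > 0" using elim by (simp add: K_def)
      have \<mu>n: "\<mu> n = real (m n) * T v / K" by (simp add: \<mu>_def v_def K_def)
      define c where "c \<omega> = N n v \<omega> - real (m n) * T v" for \<omega>
      have [measurable]: "random_variable borel c" unfolding c_def by measurable
      have ic: "integrable M (\<lambda>\<omega>. (c \<omega>)\<^sup>2)"
      proof (rule integrable_const_bound[of _ "(real (m n) + real (m n) * T v)\<^sup>2"])
        show "AE \<omega> in M. norm ((c \<omega>)\<^sup>2) \<le> (real (m n) + real (m n) * T v)\<^sup>2"
        proof (intro AE_I2)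
          fix \<omega>
          have "real (m n) * T v \<ge> 0" using T_nonneg by simp
          then have "\<bar>c \<omega>\<bar> \<le> \<bar>real (m n) + real (m n) * T v\<bar>"
            using N_nonneg[of n v \<omega>] N_le[of n v \<omega>] by (simp add: c_def)
          then show "norm ((c \<omega>)\<^sup>2) \<le> (real (m n) + real (m n) * T v)\<^sup>2"
            by (simp add: abs_le_square_iff)
        qed
      qed simp
      have "expectation (\<lambda>\<omega>. \<bar>c \<omega>\<bar>) \<le> sqrt (expectation (\<lambda>\<omega>. (c \<omega>)\<^sup>2))"
        by (rule expectation_abs_le_sqrt[OF _ ic]) simp
      also have "\<dots> \<le> sqrt (real (m n) * T v)"
        using variance_N[of n v] by (simp add: expectation_N c_def)
      finally have *: "expectation (\<lambda>\<omega>. \<bar>c \<omega>\<bar>) \<le> sqrt (real (m n) * T v)" .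
      have int_c: "integrable M (\<lambda>\<omega>. \<bar>c \<omega>\<bar>)" unfolding c_def using integrable_N by auto
      have "expectation (\<lambda>\<omega>. \<bar>N n v \<omega> / K - \<theta>\<bar>) \<le> expectation (\<lambda>\<omega>. \<bar>c \<omega>\<bar> / K + \<bar>\<mu> n - \<theta>\<bar>)"
      proof (intro integral_mono integrable_N_dev)
        fix \<omega>
        have "N n v \<omega> / K - \<theta> = c \<omega> / K + (\<mu> n - \<theta>)"
          using K by (simp add: c_def \<mu>n diff_divide_distrib)
        then show "\<bar>N n v \<omega> / K - \<theta>\<bar> \<le> \<bar>c \<omega>\<bar> / K + \<bar>\<mu> n - \<theta>\<bar>"
          using abs_triangle_ineq[of "c \<omega> / K" "\<mu> n - \<theta>"] K by simp
      qed (use int_c in auto)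
      also have "\<dots> = expectation (\<lambda>\<omega>. \<bar>c \<omega>\<bar>) / K + \<bar>\<mu> n - \<theta>\<bar>"
        using int_c by (simp add: prob_space)
      also have "\<dots> \<le> sqrt (real (m n) * T v) / K + \<bar>\<mu> n - \<theta>\<bar>"
        using * K by (intro add_right_mono divide_right_mono) auto
      also have "sqrt (real (m n) * T v) / K = sqrt (\<mu> n / K)"
        using K by (simp add: \<mu>n real_sqrt_divide)
      finally show ?case by (simp add: v_def K_def \<theta>_def)
    qed
  qed auto
qed

lemma N_whp:
  assumes y: "y > 0"
  shows "((\<lambda>p. N (fst p) (y * b (fst p)) (snd p) / real (k (fst p))) \<longlongrightarrow> y powr (- 1 / \<gamma>)) (whp M)"
proof -
  have "((\<lambda>p. \<bar>N (fst p) (y * b (fst p)) (snd p) / real (k (fst p)) - y powr (- 1 / \<gamma>)\<bar>) \<longlongrightarrow> 0) (whp M)"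
    by (rule tendsto_whp_of_L1[of "\<lambda>n \<omega>. \<bar>N n (y * b n) \<omega> / real (k n) - y powr (- 1 / \<gamma>)\<bar>"])
       (use N_L1[OF y] integrable_N_dev in auto)
  then show ?thesis
    by (simp add: tendsto_rabs_zero_iff LIM_zero_iff)
qed

section \<open>Convergence of grid sums of exceedance counts\<close>

lemma summable_N:
  assumes "q > 1" "a > 0"
  shows "summable (\<lambda>j. c ^ j * N n (a * q ^ j) \<omega>)"
  unfolding N_def sum_distrib_left
  by (intro summable_sum grid_summable assms)

lemma grid_whp:
  assumes q: "q > 1" and r: "\<gamma> * r < 1" and y: "y > 0"
  shows "((\<lambda>p. \<Sum>j. (q powr r) ^ j * (N (fst p) (y * q ^ j * b (fst p)) (snd p) / real (k (fst p))))
     \<longlongrightarrow> y powr (- 1 / \<gamma>) / (1 - q powr (r - 1 / \<gamma>))) (whp M)"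
proof -
  define c where "c = q powr r"
  define \<theta> where "\<theta> j = y powr (- 1 / \<gamma>) * (q powr (- 1 / \<gamma>)) ^ j" for j :: nat
  have \<theta>: "\<theta> j = (y * q ^ j) powr (- 1 / \<gamma>)" for j
    using q y by (simp add: \<theta>_def powr_mult powr_power powr_realpow[symmetric] powr_powr mult.commute)
  have \<theta>0: "\<theta> j \<ge> 0" for j by (simp add: \<theta>_def)
  have c0: "c > 0" using q by (simp add: c_def)
  have r1: "r < 1 / \<gamma>" using r gpos by (simp add: field_simps)
  have "max 1 c < q powr (1 / \<gamma>)" using r1 q gpos by (simp add: c_def)
  \<comment> \<open>The upper bound on \<open>\<rho>\<close> is the one demanded by
    \<open>tail_geometric_bound\<close>; the lower bound makes \<open>(c / \<rho>) ^ j\<close>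
    summable. Both fit because \<open>r < 1 / \<gamma>\<close>.\<close>
  then obtain \<rho> where \<rho>: "max 1 c < \<rho>" "\<rho> < q powr (1 / \<gamma>)" using dense by blast
  define f where "f j n \<omega> = c ^ j * \<bar>N n (y * q ^ j * b n) \<omega> / real (k n) - \<theta> j\<bar>" for j n \<omega>
  define a where "a j n = expectation (f j n)" for j n
  obtain p where p: "eventually (\<lambda>t. \<forall>j\<ge>p. t * T (y * q ^ j * U t) \<le> \<rho> ^ p * (1 / \<rho>) ^ j) at_top"
    using tail_geometric_bound[OF q _ \<rho>(2) y] \<rho>(1) by auto
  define B where "B j = \<rho> ^ p * (c / \<rho>) ^ j + c ^ j * \<theta> j" for j
  have cq: "c * q powr (- 1 / \<gamma>) = q powr (r - 1 / \<gamma>)"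
    by (simp add: c_def powr_add[symmetric])
  have cq1: "q powr (r - 1 / \<gamma>) < 1" using q r1 by (simp add: powr_less_one)
  have c\<theta>: "c ^ j * \<theta> j = y powr (- 1 / \<gamma>) * (q powr (r - 1 / \<gamma>)) ^ j" for j
    by (simp add: \<theta>_def cq[symmetric] power_mult_distrib)
  have sum\<theta>: "(\<lambda>j. c ^ j * \<theta> j) sums (y powr (- 1 / \<gamma>) / (1 - q powr (r - 1 / \<gamma>)))"
    using sums_mult[OF geometric_sums[of "q powr (r - 1 / \<gamma>)"], of "y powr (- 1 / \<gamma>)"] cq1
    by (simp add: c\<theta>)
  have sB: "summable B"
    unfolding B_def using \<rho> c0
    by (intro summable_add summable_mult summable_geometric sums_summable[OF sum\<theta>]) auto
  have int_f: "integrable M (f j n)" for j n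
    unfolding f_def using integrable_N_dev by auto
  have f0: "f j n \<omega> \<ge> 0" for j n \<omega> using c0 by (simp add: f_def)
  have lim: "(\<lambda>n. a j n) \<longlonglongrightarrow> 0" for j
  proof -
    have "y * q ^ j > 0" using y q by simp
    from tendsto_mult[OF tendsto_const[of "c ^ j"] N_L1[OF this]]
    show ?thesis by (simp add: a_def f_def[abs_def] \<theta>)
  qed
  have bound: "eventually (\<lambda>(j, n). norm (a j n) \<le> B j) (at_top \<times>\<^sub>F sequentially)"
  proof -
    have "eventually (\<lambda>n. \<forall>j\<ge>p. real (m n) / real (k n) * T (y * q ^ j * b n) \<le> \<rho> ^ p * (1 / \<rho>) ^ j) sequentially"
      unfolding b_def by (rule eventually_compose_filterlim[OF p mk_inf])
    then have "eventually (\<lambda>n. \<forall>j\<ge>p. norm (a j n) \<le> B j) sequentially"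
    proof eventually_elim
      case (elim n)
      show ?case
      proof (intro allI impI)
        fix j assume "j \<ge> p"
        have "norm (a j n) = a j n" by (simp add: a_def f0)
        also have "\<dots> = c ^ j * expectation (\<lambda>\<omega>. \<bar>N n (y * q ^ j * b n) \<omega> / real (k n) - \<theta> j\<bar>)"
          by (simp add: a_def f_def[abs_def])
        also have "\<dots> \<le> c ^ j * (\<rho> ^ p * (1 / \<rho>) ^ j + \<theta> j)"
          using expectation_N_dev_le[OF \<theta>0, of n "y * q ^ j * b n" j] elim \<open>j \<ge> p\<close> c0
          by (intro mult_left_mono) (auto intro: order.trans)
        also have "\<dots> = B j" by (simp add: B_def algebra_simps power_divide)
        finally show "norm (a j n) \<le> B j" .
      qed
    qed
    then show ?thesis
      unfolding eventually_prod_filter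
      by (intro exI[of _ "\<lambda>j. j \<ge> p"] exI[of _ "\<lambda>n. \<forall>j\<ge>p. norm (a j n) \<le> B j"])
        (auto simp: eventually_ge_at_top)
  qed
  \<comment> \<open>Tannery's theorem is dominated convergence for series: each \<open>a j n\<close>
    tends to 0 under the summable bound \<open>B\<close>, so the sum over \<open>j\<close> tends to
    0 as well.\<close>
  note tan = tannerys_theorem[OF lim bound sB sequentially_bot]
  define D where "D n \<omega> = (\<Sum>j. f j n \<omega>)" for n \<omega>
  have good: "eventually (\<lambda>n. b n > 0 \<and> summable (\<lambda>j. norm (a j n))) sequentially"
    using eventually_k_m tan by (auto elim: eventually_elim2)
  have sN: "summable (\<lambda>j. c ^ j * (N n (y * q ^ j * b n) \<omega> / real (k n)))" if "b n > 0" for n \<omega>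
    using summable_divide[OF summable_N[OF q, of "y * b n" c n \<omega>], of "real (k n)"] that y
    by (simp add: mult_ac)
  have sf: "summable (\<lambda>j. f j n \<omega>)" if "b n > 0" for n \<omega>
  proof (rule summable_comparison_test)
    show "summable (\<lambda>j. c ^ j * (N n (y * q ^ j * b n) \<omega> / real (k n)) + c ^ j * \<theta> j)"
      by (intro summable_add sN that sums_summable[OF sum\<theta>])
    show "\<exists>N0. \<forall>j\<ge>N0. norm (f j n \<omega>) \<le> c ^ j * (N n (y * q ^ j * b n) \<omega> / real (k n)) + c ^ j * \<theta> j"
    proof (intro exI allI impI)
      fix j
      have "N n (y * q ^ j * b n) \<omega> / real (k n) \<ge> 0" using N_nonneg by simp
      then have "\<bar>N n (y * q ^ j * b n) \<omega> / real (k n) - \<theta> j\<bar> \<le> N n (y * q ^ j * b n) \<omega> / real (k n) + \<theta> j"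
        using \<theta>0[of j] by simp
      then have "c ^ j * \<bar>N n (y * q ^ j * b n) \<omega> / real (k n) - \<theta> j\<bar> \<le>
          c ^ j * (N n (y * q ^ j * b n) \<omega> / real (k n) + \<theta> j)"
        using c0 by (intro mult_left_mono) auto
      then show "norm (f j n \<omega>) \<le> c ^ j * (N n (y * q ^ j * b n) \<omega> / real (k n)) + c ^ j * \<theta> j"
        using f0[of j n \<omega>] by (simp add: f_def distrib_left)
    qed
  qed
  \<comment> \<open>Summability of the expected absolute terms permits exchanging series and
    expectation.\<close>
  have intD: "integrable M (D n)" "expectation (D n) = (\<Sum>j. a j n)"
    if "b n > 0" "summable (\<lambda>j. norm (a j n))" for n
  proof -
    have "AE \<omega> in M. summable (\<lambda>j. norm (f j n \<omega>))" using sf[OF that(1)] f0 by simp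
    moreover have "summable (\<lambda>j. expectation (\<lambda>\<omega>. norm (f j n \<omega>)))"
      using summable_norm_cancel[OF that(2)] f0 by (simp add: a_def)
    ultimately show "integrable M (D n)" "expectation (D n) = (\<Sum>j. a j n)"
      unfolding D_def a_def using integrable_suminf[of M "\<lambda>j. f j n"] integral_suminf[of M "\<lambda>j. f j n"] int_f
      by auto
  qed
  have D0: "((\<lambda>p. D (fst p) (snd p)) \<longlongrightarrow> 0) (whp M)"
  proof (rule tendsto_whp_of_L1)
    show "\<forall>\<^sub>F n in sequentially. integrable M (D n) \<and> (\<forall>\<omega>\<in>space M. 0 \<le> D n \<omega>)"
      using good by eventually_elim (auto simp: intD, auto simp: D_def intro!: suminf_nonneg sf f0)
    have "(\<lambda>n. \<Sum>j. a j n) \<longlonglongrightarrow> 0" using tan by simp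
    then show "(\<lambda>n. expectation (D n)) \<longlonglongrightarrow> 0"
      by (rule Lim_transform_eventually) (use good in \<open>eventually_elim, simp add: intD\<close>)
  qed
  have "eventually (\<lambda>p. b (fst p) > 0) (whp M)"
    using eventually_k_m by (intro eventually_compose_filterlim[OF _ filterlim_fst_whp]) (auto elim: eventually_mono)
  then have "eventually (\<lambda>p. norm ((\<Sum>j. (q powr r) ^ j * (N (fst p) (y * q ^ j * b (fst p)) (snd p) / real (k (fst p)))) -
      y powr (- 1 / \<gamma>) / (1 - q powr (r - 1 / \<gamma>))) \<le> D (fst p) (snd p)) (whp M)"
  proof eventually_elim
    case (elim p)
    obtain n \<omega> where [simp]: "p = (n, \<omega>)" by (cases p)
    from elim have bn: "b n > 0" by simp
    have "(\<Sum>j. c ^ j * (N n (y * q ^ j * b n) \<omega> / real (k n))) - y powr (- 1 / \<gamma>) / (1 - q powr (r - 1 / \<gamma>))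
        = (\<Sum>j. c ^ j * (N n (y * q ^ j * b n) \<omega> / real (k n)) - c ^ j * \<theta> j)"
      using suminf_diff[OF sN[OF bn] sums_summable[OF sum\<theta>]] sums_unique[OF sum\<theta>] by simp
    moreover have "\<bar>\<Sum>j. c ^ j * (N n (y * q ^ j * b n) \<omega> / real (k n)) - c ^ j * \<theta> j\<bar> \<le> D n \<omega>"
    proof -
      have e: "f j n \<omega> = \<bar>c ^ j * (N n (y * q ^ j * b n) \<omega> / real (k n)) - c ^ j * \<theta> j\<bar>" for j
        unfolding right_diff_distrib[symmetric] abs_mult f_def using c0 by simp
      show ?thesis
        unfolding D_def e by (rule summable_rabs) (use sf[OF bn, of \<omega>] in \<open>simp add: e\<close>)
    qed
    ultimately show ?case by (simp add: c_def)
  qed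
  from Lim_null_comparison[OF this D0] show ?thesis by (simp add: LIM_zero_iff)
qed


section \<open>Localisation of the random threshold and enclosure of the power moment\<close>

lemma length_filter_xs: "real (length (filter (\<lambda>x. v < x) (xs n \<omega>))) = N n v \<omega>"
proof -
  have "N n v \<omega> = (\<Sum>i<m n. if v < X i \<omega> then 1 else 0)"
    unfolding N_def by (intro sum.cong) (auto simp: indicator_def)
  also have "\<dots> = real (card ({..<m n} \<inter> {i. v < X i \<omega>}))"
    by (simp add: sum.If_cases)
  also have "{..<m n} \<inter> {i. v < X i \<omega>} = {i. i < m n \<and> v < xs n \<omega> ! i}"
    by (auto simp: xs_def)
  finally show ?thesis by (simp add: length_filter_conv_card)
qed

lemma eventually_whp_k_m: "eventually (\<lambda>p. 1 \<le> k (fst p) \<and> k (fst p) < m (fst p) \<and> b (fst p) > 0) (whp M)"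
  by (rule eventually_compose_filterlim[OF eventually_k_m filterlim_fst_whp])

text \<open>The normalised count above \<open>b / q\<close> tends to
  \<open>q powr (1 / \<gamma>) > 1\<close> and the count above \<open>q * b\<close> to
  \<open>q powr (- 1 / \<gamma>) < 1\<close>. So eventually more than \<open>k\<close> points exceed
  the first level and fewer than \<open>k\<close> the second.\<close>

lemma Z_whp:
  assumes q: "q > 1"
  shows "eventually (\<lambda>p. b (fst p) / q < Z (fst p) (snd p) \<and> Z (fst p) (snd p) \<le> q * b (fst p)) (whp M)"
proof -
  have "(1 / q) powr (- 1 / \<gamma>) = q powr (1 / \<gamma>)"
    using q by (simp add: powr_divide powr_minus)
  moreover have "q powr (1 / \<gamma>) > 1" using q gpos by simp
  ultimately have 1: "(1 / q) powr (- 1 / \<gamma>) > 1" by simp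
  have 2: "q powr (- 1 / \<gamma>) < 1" using q gpos by (simp add: powr_less_one)
  have "eventually (\<lambda>p. N (fst p) (1 / q * b (fst p)) (snd p) / real (k (fst p)) > 1) (whp M)"
    by (rule order_tendstoD(1)[OF N_whp 1]) (use q in auto)
  moreover have "eventually (\<lambda>p. N (fst p) (q * b (fst p)) (snd p) / real (k (fst p)) < 1) (whp M)"
    by (rule order_tendstoD(2)[OF N_whp 2]) (use q in auto)
  ultimately show ?thesis using eventually_whp_k_m
  proof eventually_elim
    case (elim p)
    obtain n \<omega> where [simp]: "p = (n, \<omega>)" by (cases p)
    have "N n (b n / q) \<omega> > real (k n)" "N n (q * b n) \<omega> < real (k n)"
      using elim by (auto simp: field_simps)
    then have "k n < length (filter (\<lambda>x. b n / q < x) (xs n \<omega>))"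
        "\<not> k n < length (filter (\<lambda>x. q * b n < x) (xs n \<omega>))"
      unfolding length_filter_xs[symmetric] by linarith+
    then show ?case
      using ord_stat_greater_iff[of "k n" "xs n \<omega>" "b n / q"]
        ord_stat_greater_iff[of "k n" "xs n \<omega>" "q * b n"] elim by (auto simp: Z_def not_less)
  qed
qed

lemma Z_pos_whp: "eventually (\<lambda>p. Z (fst p) (snd p) > 0) (whp M)"
  using Z_whp[of 2, simplified] eventually_whp_k_m by eventually_elim auto

lemma sum_grid_eq:
  assumes "q > 1" "a > 0"
  shows "(\<Sum>i<m n. \<Sum>j. c ^ j * indicator {a * q ^ j<..} (X i \<omega>)) = (\<Sum>j. c ^ j * N n (a * q ^ j) \<omega>)"
  unfolding N_def sum_distrib_left
  by (rule suminf_sum[symmetric]) (intro grid_summable assms)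

text \<open>Summing the pointwise grid bounds over the sample and exchanging the sums. The grid
  start \<open>a\<close> can be deterministic, which removes the random threshold from
  \<open>V\<close>.\<close>

lemma G_stat_0_grid_bounds:
  assumes q: "q > 1" and r: "r \<noteq> 0" and km: "1 \<le> k n" "k n < m n" and a: "a > 0" and Z: "Z n \<omega> > 0"
  defines "W \<equiv> (G_stat (k n) r 0 (xs n \<omega>) - 1) / (q powr r - 1)"
    and "V \<equiv> (\<Sum>j. (q powr r) ^ j * (N n (a * q ^ j) \<omega> / real (k n)))"
  shows "a \<le> Z n \<omega> \<Longrightarrow> W \<le> V" and "q * Z n \<omega> \<le> a \<Longrightarrow> V \<le> W"
proof -
  define h where "h x = (max (x / Z n \<omega>) 1 powr r - 1) / (q powr r - 1)" for x
  have "G_stat (k n) r 0 (xs n \<omega>) - 1 = (\<Sum>x\<leftarrow>xs n \<omega>. max (x / Z n \<omega>) 1 powr r - 1) / real (k n)"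
    unfolding Z_def using G_stat_0_eq_sum_list[of "k n" "xs n \<omega>" r] km Z by (simp add: Z_def)
  also have "(\<Sum>x\<leftarrow>xs n \<omega>. max (x / Z n \<omega>) 1 powr r - 1) = (\<Sum>i<m n. max (X i \<omega> / Z n \<omega>) 1 powr r - 1)"
    by (simp add: xs_def comp_def interv_sum_list_conv_sum_set_nat atLeast0LessThan)
  finally have W: "W = (\<Sum>i<m n. h (X i \<omega>)) / real (k n)"
    by (simp add: W_def h_def sum_divide_distrib mult.commute)
  have V: "V = (\<Sum>i<m n. \<Sum>j. (q powr r) ^ j * indicator {a * q ^ j<..} (X i \<omega>)) / real (k n)"
    unfolding sum_grid_eq[OF q a] V_def
    using suminf_divide[OF summable_N[OF q a, of "q powr r" n \<omega>], of "real (k n)"] by simp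
  show "W \<le> V" if "a \<le> Z n \<omega>"
    unfolding W V h_def
    by (intro divide_right_mono sum_mono grid_sum_bounds(1) q r a Z that) simp
  show "V \<le> W" if "q * Z n \<omega> \<le> a"
    unfolding W V h_def
    by (intro divide_right_mono sum_mono grid_sum_bounds(2) q r a Z that) simp
qed

section \<open>Limits of the power moment and the log-moment\<close>

lemma G_stat_0_whp:
  assumes r: "r \<noteq> 0" "\<gamma> * r < 1"
  shows "((\<lambda>p. G_stat (k (fst p)) r 0 (xs (fst p) (snd p))) \<longlongrightarrow> 1 / (1 - \<gamma> * r)) (whp M)"
proof -
  define s where "s = r - 1 / \<gamma>"
  have s: "s < 0" using r gpos by (simp add: s_def field_simps)
  \<comment> \<open>Dividing by \<open>r\<close> makes the factor positive for either sign of
    \<open>r\<close>, so multiplying by it preserves the enclosing inequalities.\<close>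
  define e where "e q = (q powr r - 1) / r" for q
  have e: "e q > 0" if "q > 1" for q
  proof (cases "r > 0")
    case True
    then show ?thesis using that by (simp add: e_def)
  next
    case False
    then have "q powr r < 1" using that r by (simp add: powr_less_one)
    then show ?thesis using False r by (simp add: e_def divide_neg_neg)
  qed
  define V where "V y q p = (\<Sum>j. (q powr r) ^ j * (N (fst p) (y * q ^ j * b (fst p)) (snd p) / real (k (fst p))))"
    for y q p
  define lim where "lim y q = e q * (y powr (- 1 / \<gamma>) / (1 - q powr s))" for y q
  have V: "((\<lambda>p. e q * V y q p) \<longlongrightarrow> lim y q) (whp M)" if "q > 1" "y > 0" for q y
    unfolding lim_def V_def s_def using that
    by (intro tendsto_intros grid_whp r) auto
  \<comment> \<open>As \<open>q\<close> decreases to 1, \<open>e q\<close> behaves like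
    \<open>ln q\<close> and \<open>1 - q powr s\<close> like \<open>- s * ln q\<close>.\<close>
  have base: "((\<lambda>q. e q / (1 - q powr s)) \<longlongrightarrow> - 1 / s) (at_right 1)"
  proof -
    have "((\<lambda>q. e q / (1 - q powr s)) \<longlongrightarrow> - (r * inverse r * inverse s)) (at_right 1)"
      unfolding e_def using r(1) s by real_asymp
    then show ?thesis using r(1) by (simp add: field_simps)
  qed
  have lim_lo: "((\<lambda>q. lim (q ^ 2) q) \<longlongrightarrow> - 1 / s) (at_right 1)"
  proof -
    have "((\<lambda>q. e q / (1 - q powr s) * (q ^ 2) powr (- 1 / \<gamma>)) \<longlongrightarrow> (- 1 / s) * (1 ^ 2) powr (- 1 / \<gamma>)) (at_right 1)"
      by (intro tendsto_intros base) auto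
    then show ?thesis by (simp add: lim_def mult_ac)
  qed
  have lim_hi: "((\<lambda>q. lim (1 / q) q) \<longlongrightarrow> - 1 / s) (at_right 1)"
  proof -
    have "((\<lambda>q. e q / (1 - q powr s) * (1 / q) powr (- 1 / \<gamma>)) \<longlongrightarrow> (- 1 / s) * (1 / 1) powr (- 1 / \<gamma>)) (at_right 1)"
      by (intro tendsto_intros base) auto
    then show ?thesis by (simp add: lim_def mult_ac)
  qed
  define W where "W p = (G_stat (k (fst p)) r 0 (xs (fst p) (snd p)) - 1) / r" for p
  \<comment> \<open>The threshold lies between \<open>b / q\<close> and \<open>q * b\<close>; hence
    \<open>b / q\<close> is a grid start below \<open>Z\<close>, and \<open>q ^ 2 * b\<close> is at
    least \<open>q * Z\<close>, as the two grid bounds require.\<close>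
  have bounds: "eventually (\<lambda>p. e q * V (q ^ 2) q p \<le> W p \<and> W p \<le> e q * V (1 / q) q p) (whp M)"
    if q: "q > 1" for q
    using Z_whp[OF q] eventually_whp_k_m Z_pos_whp
  proof eventually_elim
    case (elim p)
    obtain n \<omega> where [simp]: "p = (n, \<omega>)" by (cases p)
    have km: "1 \<le> k n" "k n < m n" and b0: "b n > 0" and Z0: "Z n \<omega> > 0" using elim by auto
    define W' where "W' = (G_stat (k n) r 0 (xs n \<omega>) - 1) / (q powr r - 1)"
    have ne: "q powr r \<noteq> 1" using q r by simp
    have W: "W p = e q * W'" using ne by (simp add: W_def W'_def e_def)
    have "W' \<le> V (1 / q) q p"
      using G_stat_0_grid_bounds(1)[OF q r(1) km _ Z0, of "b n / q"] elim q b0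
      by (simp add: W'_def V_def mult_ac)
    moreover have "V (q ^ 2) q p \<le> W'"
    proof -
      have "q * Z n \<omega> \<le> q ^ 2 * b n"
        using elim q by (simp add: power2_eq_square mult.assoc)
      then show ?thesis
        using G_stat_0_grid_bounds(2)[OF q r(1) km _ Z0, of "q ^ 2 * b n"] q b0
        by (simp add: W'_def V_def mult_ac)
    qed
    ultimately show ?case using e[OF q] W by simp
  qed
  \<comment> \<open>First \<open>q\<close> is fixed so that the limit of the enclosing grid sum is
    on the correct side of \<open>\<alpha>\<close>; only then does \<open>n\<close> grow.\<close>
  have "(W \<longlongrightarrow> - 1 / s) (whp M)"
  proof (rule order_tendstoI)
    fix \<alpha> assume "\<alpha> < - 1 / s"
    then have "eventually (\<lambda>q. \<alpha> < lim (q ^ 2) q) (at_right 1)"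
      by (rule order_tendstoD[OF lim_lo])
    then have "eventually (\<lambda>q. \<alpha> < lim (q ^ 2) q \<and> q > 1) (at_right 1)"
      using eventually_at_right_less by eventually_elim simp
    then obtain q where q: "\<alpha> < lim (q ^ 2) q" "q > 1"
      using eventually_happens' trivial_limit_at_right_real by blast
    have "eventually (\<lambda>p. \<alpha> < e q * V (q ^ 2) q p) (whp M)"
      using q by (intro order_tendstoD(1)[OF V]) auto
    then show "eventually (\<lambda>p. \<alpha> < W p) (whp M)"
      using bounds[OF q(2)] by eventually_elim simp
  next
    fix \<alpha> assume "- 1 / s < \<alpha>"
    then have "eventually (\<lambda>q. lim (1 / q) q < \<alpha>) (at_right 1)"
      by (rule order_tendstoD[OF lim_hi])
    then have "eventually (\<lambda>q. lim (1 / q) q < \<alpha> \<and> q > 1) (at_right 1)"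
      using eventually_at_right_less by eventually_elim simp
    then obtain q where q: "lim (1 / q) q < \<alpha>" "q > 1"
      using eventually_happens' trivial_limit_at_right_real by blast
    have "eventually (\<lambda>p. e q * V (1 / q) q p < \<alpha>) (whp M)"
      using q by (intro order_tendstoD(2)[OF V]) auto
    then show "eventually (\<lambda>p. W p < \<alpha>) (whp M)"
      using bounds[OF q(2)] by eventually_elim simp
  qed
  from tendsto_add[OF tendsto_const[of 1] tendsto_mult[OF tendsto_const[of r] this]]
  have "((\<lambda>p. G_stat (k (fst p)) r 0 (xs (fst p) (snd p))) \<longlongrightarrow> 1 + r * (- 1 / s)) (whp M)"
    using r by (simp add: W_def)
  moreover have "1 + r * (- 1 / s) = 1 / (1 - \<gamma> * r)"
    using s r gpos by (simp add: s_def field_simps)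
  ultimately show ?thesis by simp
qed

lemma G_stat_1_whp:
  assumes r: "r \<noteq> 0" "\<gamma> * r < 1"
  shows "((\<lambda>p. G_stat (k (fst p)) r 1 (xs (fst p) (snd p))) \<longlongrightarrow> \<gamma> / (1 - \<gamma> * r)\<^sup>2) (whp M)"
proof -
  define G where "G s p = G_stat (k (fst p)) s 0 (xs (fst p) (snd p))" for s p
  \<comment> \<open>This is the difference quotient of \<open>1 / (1 - \<gamma> * s)\<close> in
    \<open>s\<close> at \<open>r\<close> with step \<open>d\<close>, in a closed form that is
    continuous at \<open>d = 0\<close>.\<close>
  define Q where "Q d = \<gamma> / ((1 - \<gamma> * (r + d)) * (1 - \<gamma> * r))" for d
  have quot: "((\<lambda>p. (G (r + d) p - G r p) / d) \<longlongrightarrow> Q d) (whp M)"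
    if d: "d \<noteq> 0" "r + d \<noteq> 0" "\<gamma> * (r + d) < 1" for d
  proof -
    have "((\<lambda>p. (G (r + d) p - G r p) / d) \<longlongrightarrow> (1 / (1 - \<gamma> * (r + d)) - 1 / (1 - \<gamma> * r)) / d) (whp M)"
      unfolding G_def by (intro tendsto_intros G_stat_0_whp r d)
    also have "1 / (1 - \<gamma> * (r + d)) - 1 / (1 - \<gamma> * r) = Q d * d"
      using r d by (simp add: Q_def diff_frac_eq) (simp add: algebra_simps)
    finally show ?thesis using d by simp
  qed
  have Q0: "Q 0 = \<gamma> / (1 - \<gamma> * r)\<^sup>2" by (simp add: Q_def power2_eq_square)
  have "isCont Q 0" unfolding Q_def using r by (intro continuous_intros) auto
  then have Qlim: "(Q \<longlongrightarrow> \<gamma> / (1 - \<gamma> * r)\<^sup>2) (at 0)" by (simp add: isCont_def Q0)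
  \<comment> \<open>Small steps avoid the exponent 0, excluded in \<open>G_stat_0_whp\<close>, and
    stay below \<open>1 / \<gamma>\<close>.\<close>
  have ok: "eventually (\<lambda>d. d \<noteq> 0 \<and> r + d \<noteq> 0 \<and> \<gamma> * (r + d) < 1) (at 0)"
  proof -
    have "((\<lambda>d. r + d) \<longlongrightarrow> r + 0) (at 0)" by (intro tendsto_intros)
    then have "eventually (\<lambda>d. r + d \<noteq> 0) (at 0)" using r by (intro tendsto_imp_eventually_ne) auto
    moreover have "((\<lambda>d. \<gamma> * (r + d)) \<longlongrightarrow> \<gamma> * (r + 0)) (at 0)" by (intro tendsto_intros)
    then have "eventually (\<lambda>d. \<gamma> * (r + d) < 1) (at 0)" using r by (intro order_tendstoD(2)) auto
    ultimately show ?thesis using eventually_neq_at_within[of 0] by eventually_elim simp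
  qed
  \<comment> \<open>By convexity, slopes to the right bound the log-moment from above and slopes to
    the left from below; hence the one-sided choices of \<open>d\<close> that follow.\<close>
  have bounds: "eventually (\<lambda>p. \<forall>d. (d > 0 \<longrightarrow> G_stat (k (fst p)) r 1 (xs (fst p) (snd p)) \<le> (G (r + d) p - G r p) / d) \<and>
      (d < 0 \<longrightarrow> (G (r + d) p - G r p) / d \<le> G_stat (k (fst p)) r 1 (xs (fst p) (snd p)))) (whp M)"
    using eventually_whp_k_m Z_pos_whp
  proof eventually_elim
    case (elim p)
    obtain n \<omega> where [simp]: "p = (n, \<omega>)" by (cases p)
    have *: "1 \<le> k n" "k n < length (xs n \<omega>)" "ord_stat (xs n \<omega>) (length (xs n \<omega>) - k n) > 0"
      using elim by (auto simp: Z_def)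
    show ?case
    proof (intro allI conjI impI)
      fix d :: real assume "d > 0"
      with G_stat_1_bounds(1)[OF *, of d r]
      show "G_stat (k (fst p)) r 1 (xs (fst p) (snd p)) \<le> (G (r + d) p - G r p) / d"
        by (simp add: G_def)
    next
      fix d :: real assume "d < 0"
      with G_stat_1_bounds(2)[OF *, of "- d" r]
      show "(G (r + d) p - G r p) / d \<le> G_stat (k (fst p)) r 1 (xs (fst p) (snd p))"
        by (simp add: G_def minus_divide_left)
    qed
  qed
  show ?thesis
  proof (rule order_tendstoI)
    fix \<alpha> assume "\<alpha> < \<gamma> / (1 - \<gamma> * r)\<^sup>2"
    then have "eventually (\<lambda>d. \<alpha> < Q d) (at 0)" by (rule order_tendstoD[OF Qlim])
    then have "eventually (\<lambda>d. \<alpha> < Q d \<and> d \<noteq> 0 \<and> r + d \<noteq> 0 \<and> \<gamma> * (r + d) < 1) (at 0)"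
      using ok by eventually_elim simp
    then have "eventually (\<lambda>d. \<alpha> < Q d \<and> d \<noteq> 0 \<and> r + d \<noteq> 0 \<and> \<gamma> * (r + d) < 1) (at_left 0)"
      by (simp add: eventually_at_split)
    then have "eventually (\<lambda>d. d < 0 \<and> \<alpha> < Q d \<and> r + d \<noteq> 0 \<and> \<gamma> * (r + d) < 1) (at_left 0)"
      using eventually_at_left_real[of "-1" 0] by (auto elim: eventually_elim2)
    then obtain d where d: "d < 0" "\<alpha> < Q d" "r + d \<noteq> 0" "\<gamma> * (r + d) < 1"
      using eventually_happens' trivial_limit_at_left_real by blast
    have "eventually (\<lambda>p. \<alpha> < (G (r + d) p - G r p) / d) (whp M)"
      using d by (intro order_tendstoD(1)[OF quot]) auto
    then show "eventually (\<lambda>p. \<alpha> < G_stat (k (fst p)) r 1 (xs (fst p) (snd p))) (whp M)"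
      using bounds by eventually_elim (use d in force)
  next
    fix \<alpha> assume "\<gamma> / (1 - \<gamma> * r)\<^sup>2 < \<alpha>"
    then have "eventually (\<lambda>d. Q d < \<alpha>) (at 0)" by (rule order_tendstoD[OF Qlim])
    then have "eventually (\<lambda>d. Q d < \<alpha> \<and> d \<noteq> 0 \<and> r + d \<noteq> 0 \<and> \<gamma> * (r + d) < 1) (at 0)"
      using ok by eventually_elim simp
    then have "eventually (\<lambda>d. Q d < \<alpha> \<and> d \<noteq> 0 \<and> r + d \<noteq> 0 \<and> \<gamma> * (r + d) < 1) (at_right 0)"
      by (simp add: eventually_at_split)
    then have "eventually (\<lambda>d. d > 0 \<and> Q d < \<alpha> \<and> r + d \<noteq> 0 \<and> \<gamma> * (r + d) < 1) (at_right 0)"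
      using eventually_at_right_less by eventually_elim simp
    then obtain d where d: "d > 0" "Q d < \<alpha>" "r + d \<noteq> 0" "\<gamma> * (r + d) < 1"
      using eventually_happens' trivial_limit_at_right_real by blast
    have "eventually (\<lambda>p. (G (r + d) p - G r p) / d < \<alpha>) (whp M)"
      using d by (intro order_tendstoD(2)[OF quot]) auto
    then show "eventually (\<lambda>p. G_stat (k (fst p)) r 1 (xs (fst p) (snd p)) < \<alpha>) (whp M)"
      using bounds by eventually_elim (use d in force)
  qed
qed

end

section \<open>Sending one observation to infinity\<close>

lemma g_fun_tendsto_0:
  assumes "r < 0" "u \<in> {0, 1}"
  shows "(g_fun r u \<longlongrightarrow> 0) at_top"
  using assms unfolding g_fun_def by (elim insertE emptyE; simp only:; real_asymp)

lemma g_fun_at_top: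
  assumes "r > 0" "u \<in> {0, 1}"
  shows "filterlim (g_fun r u) at_top at_top"
  using assms unfolding g_fun_def by (elim insertE emptyE; simp only:; real_asymp)

text \<open>The sample is fixed here and only the added point moves. Positivity of the threshold
  makes \<open>x / w\<close> tend to infinity with \<open>x\<close>.\<close>

locale outlier =
  fixes ys :: "real list" and k :: nat
  assumes k: "2 \<le> k" "k \<le> length ys" and pos: "ord_stat ys (length ys - (k - 1)) > 0"
begin

abbreviation "w \<equiv> ord_stat ys (length ys - (k - 1))"

abbreviation "a \<equiv> real (k - 1) / real k"

lemma scale: "filterlim (\<lambda>x. x / w) at_top at_top"
  using pos by real_asymp

lemma k_pos: "real k > 0" using k by simp

lemma eventually_G:
  "eventually (\<lambda>x. G_stat k r u (ys @ [x]) = a * G_stat (k - 1) r u ys + g_fun r u (x / w) / real k) at_top"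
  using eventually_ge_at_top[of "Max (set ys)"]
proof eventually_elim
  case (elim x)
  then show ?case
    by (intro G_stat_append_max k) (meson List.finite_set Max_ge order.trans)
qed

text \<open>A negative power damps the outlier completely; its only trace is the factor
  \<open>a = (k - 1) / k\<close>.\<close>

lemma G_tendsto_neg:
  assumes "r < 0" "u \<in> {0, 1}"
  shows "((\<lambda>x. G_stat k r u (ys @ [x])) \<longlongrightarrow> a * G_stat (k - 1) r u ys) at_top"
proof -
  have "((\<lambda>x. a * G_stat (k - 1) r u ys + g_fun r u (x / w) / real k) \<longlongrightarrow>
      a * G_stat (k - 1) r u ys + 0 / real k) at_top"
    using k_pos by (intro tendsto_intros filterlim_compose[OF g_fun_tendsto_0[OF assms] scale]) auto
  then show ?thesis
    by (subst tendsto_cong[OF eventually_G]) simp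
qed

lemma G_at_top_of_g:
  assumes "filterlim (g_fun r u) at_top at_top"
  shows "filterlim (\<lambda>x. G_stat k r u (ys @ [x])) at_top at_top"
proof -
  have g: "filterlim (\<lambda>x. g_fun r u (x / w)) at_top at_top"
    by (rule filterlim_compose[OF assms scale])
  have "filterlim (\<lambda>x. a * G_stat (k - 1) r u ys + g_fun r u (x / w) * (1 / real k)) at_top at_top"
    by (intro filterlim_tendsto_add_at_top[OF tendsto_const]
        filterlim_at_top_mult_tendsto_pos[OF tendsto_const _ g]) (use k_pos in auto)
  then show ?thesis
    by (subst filterlim_cong[OF refl refl eventually_G]) simp
qed

text \<open>The numerator grows like \<open>x powr r\<close> and the denominator like
  \<open>x powr r * ln x\<close>.\<close>

lemma G_ratio_tendsto:
  assumes r: "r > 0"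
  shows "((\<lambda>x. (G_stat k r 0 (ys @ [x]) - 1) / G_stat k r 1 (ys @ [x])) \<longlongrightarrow> 0) at_top"
proof -
  define A where "A = a * G_stat (k - 1) r 0 ys"
  define B where "B = a * G_stat (k - 1) r 1 ys"
  define K where "K = real k"
  have K: "K > 0" using k_pos by (simp add: K_def)
  have "((\<lambda>v. (A + g_fun r 0 v / K - 1) / (B + g_fun r 1 v / K)) \<longlongrightarrow> 0) at_top"
    unfolding g_fun_def power_0 power_one_right mult_1_right using r K by real_asymp
  from filterlim_compose[OF this scale] show ?thesis
    by (rule Lim_transform_eventually)
       (use eventually_G[of r 0] eventually_G[of r 1] in \<open>eventually_elim, simp add: A_def B_def K_def\<close>)
qed

text \<open>The ratio grows like \<open>ln x / 2\<close>.\<close>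

lemma G_ratio_0_at_top:
  "filterlim (\<lambda>x. G_stat k 0 2 (ys @ [x]) / (2 * G_stat k 0 1 (ys @ [x]))) at_top at_top"
proof -
  define A where "A = a * G_stat (k - 1) 0 2 ys"
  define B where "B = a * G_stat (k - 1) 0 1 ys"
  define K where "K = real k"
  have K: "K > 0" using k_pos by (simp add: K_def)
  have "filterlim (\<lambda>v. (A + (ln v)\<^sup>2 / K) / (2 * (B + ln v / K))) at_top at_top"
    using K by real_asymp
  moreover have "eventually (\<lambda>v::real. (A + (ln v)\<^sup>2 / K) / (2 * (B + ln v / K)) =
      (A + g_fun 0 2 v / K) / (2 * (B + g_fun 0 1 v / K))) at_top"
    using eventually_gt_at_top[of 0] by eventually_elim (simp add: g_fun_def)
  ultimately have "filterlim (\<lambda>v. (A + g_fun 0 2 v / K) / (2 * (B + g_fun 0 1 v / K))) at_top at_top"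
    by (subst (asm) filterlim_cong[OF refl refl])
  from filterlim_compose[OF this scale] show ?thesis
    by (rule filterlim_mono_eventually[OF _ order.refl order.refl])
       (use eventually_G[of 0 2] eventually_G[of 0 1] in \<open>eventually_elim, simp add: A_def B_def K_def\<close>)
qed

lemma gamma_hat_0_at_top: "filterlim (\<lambda>x. gamma_hat j k 0 (ys @ [x])) at_top at_top"
proof -
  have "filterlim (\<lambda>v. ln v :: real) at_top at_top" by real_asymp
  moreover have "eventually (\<lambda>v. ln v = g_fun 0 1 v) at_top"
    using eventually_gt_at_top[of 0] by eventually_elim (simp add: g_fun_def)
  ultimately have "filterlim (g_fun 0 1) at_top at_top"
    by (subst (asm) filterlim_cong[OF refl refl])
  \<comment> \<open>At \<open>r = 0\<close> the second estimator has denominator 2 and so coincides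
    with the first, the Hill estimator; the third is the ratio of log-moments.\<close>
  from G_at_top_of_g[OF this] G_ratio_0_at_top show ?thesis
    by (cases "j = 1"; cases "j = 2")
       (simp_all add: gamma_hat_def gamma_hat1_def gamma_hat2_def gamma_hat3_def)
qed

lemma gamma_hat_pos_tendsto:
  assumes r: "r > 0"
  shows "((\<lambda>x. gamma_hat j k r (ys @ [x])) \<longlongrightarrow> 1 / r) at_top"
proof -
  have G: "filterlim (\<lambda>x. G_stat k r u (ys @ [x])) at_top at_top" if "u \<in> {0, 1}" for u
    by (intro G_at_top_of_g g_fun_at_top r that)
  have 1: "((\<lambda>x. gamma_hat1 k r (ys @ [x])) \<longlongrightarrow> 1 / r) at_top"
  proof -
    have "((\<lambda>g. (g - 1) / (r * g)) \<longlongrightarrow> inverse r) at_top" using r by real_asymp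
    from filterlim_compose[OF this G[of 0]] show ?thesis using r by (simp add: gamma_hat1_def inverse_eq_divide)
  qed
  have 2: "((\<lambda>x. gamma_hat2 k r (ys @ [x])) \<longlongrightarrow> 1 / r) at_top"
  proof -
    have "((\<lambda>g. 2 * g / (2 * r * g + 1 + sqrt (4 * r * g + 1))) \<longlongrightarrow> inverse r) at_top"
      using r by real_asymp
    from filterlim_compose[OF this G[of 1]] show ?thesis by (simp add: gamma_hat2_def inverse_eq_divide)
  qed
  have 3: "((\<lambda>x. gamma_hat3 k r (ys @ [x])) \<longlongrightarrow> 1 / r) at_top"
  proof -
    \<comment> \<open>Once the log-moment is positive, the third estimator equals
      \<open>1 / r\<close> minus a multiple of the vanishing ratio.\<close>
    have "((\<lambda>x. 1 / r - (G_stat k r 0 (ys @ [x]) - 1) / G_stat k r 1 (ys @ [x]) / r\<^sup>2) \<longlongrightarrow> 1 / r - 0 / r\<^sup>2) at_top"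
      using r by (intro tendsto_intros G_ratio_tendsto) auto
    moreover have "eventually (\<lambda>x. G_stat k r 1 (ys @ [x]) > 0) at_top"
      using G[of 1] by (simp add: filterlim_at_top_dense)
    then have "eventually (\<lambda>x. 1 / r - (G_stat k r 0 (ys @ [x]) - 1) / G_stat k r 1 (ys @ [x]) / r\<^sup>2 =
        gamma_hat3 k r (ys @ [x])) at_top"
      by eventually_elim (use r in \<open>simp add: gamma_hat3_def field_simps power2_eq_square\<close>)
    ultimately show ?thesis by (simp add: tendsto_cong)
  qed
  show ?thesis using 1 2 3 by (cases "j = 1"; cases "j = 2") (simp_all add: gamma_hat_def)
qed

end

section \<open>The estimators as functions of two moments\<close>

text \<open>Outside \<open>r = 0\<close> all three estimators depend on the sample through two
  moments only, so their limits reduce to continuity at the limiting pair of moments.\<close>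

definition est :: "nat \<Rightarrow> real \<Rightarrow> real \<Rightarrow> real \<Rightarrow> real" where
  "est l r g0 g1 = (if l = 1 then (g0 - 1) / (r * g0)
     else if l = 2 then 2 * g1 / (2 * r * g1 + 1 + sqrt (4 * r * g1 + 1))
     else (r * g1 - g0 + 1) / (r\<^sup>2 * g1))"

lemma gamma_hat_eq_est:
  "r \<noteq> 0 \<Longrightarrow> gamma_hat l k r ys = est l r (G_stat k r 0 ys) (G_stat k r 1 ys)"
  by (simp add: gamma_hat_def gamma_hat1_def gamma_hat2_def gamma_hat3_def est_def)

text \<open>For \<open>\<gamma>r\<close> near -1 the radicand can be negative with positive probability; this is harmless
  because \<open>sqrt\<close> is an odd continuous function on all reals.\<close>

lemma tendsto_est:
  assumes "r \<noteq> 0" "c0 \<noteq> 0" "c1 \<noteq> 0" "2 * r * c1 + 1 + sqrt (4 * r * c1 + 1) \<noteq> 0"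
    and "(g0 \<longlongrightarrow> c0) A" "(g1 \<longlongrightarrow> c1) A"
  shows "((\<lambda>x. est l r (g0 x) (g1 x)) \<longlongrightarrow> est l r c0 c1) A"
proof -
  have "((\<lambda>x. (g0 x - 1) / (r * g0 x)) \<longlongrightarrow> (c0 - 1) / (r * c0)) A"
    using assms by (intro tendsto_intros) auto
  moreover have "((\<lambda>x. 2 * g1 x / (2 * r * g1 x + 1 + sqrt (4 * r * g1 x + 1))) \<longlongrightarrow>
      2 * c1 / (2 * r * c1 + 1 + sqrt (4 * r * c1 + 1))) A"
    using assms by (intro tendsto_intros) auto
  moreover have "((\<lambda>x. (r * g1 x - g0 x + 1) / (r\<^sup>2 * g1 x)) \<longlongrightarrow> (r * c1 - c0 + 1) / (r\<^sup>2 * c1)) A"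
    using assms by (intro tendsto_intros) auto
  ultimately show ?thesis by (simp add: est_def)
qed

text \<open>The radicand is a square because \<open>4 * \<gamma> * r + (1 - \<gamma> * r)^2 = (1 +
  \<gamma> * r)^2\<close>. The absolute value matters for \<open>\<gamma> * r < -1\<close>.\<close>

lemma sqrt_limit_moment:
  assumes "\<gamma> * r < 1"
  shows "sqrt (4 * r * (\<gamma> / (1 - \<gamma> * r)\<^sup>2) + 1) = \<bar>1 + \<gamma> * r\<bar> / (1 - \<gamma> * r)"
proof -
  have ne: "1 - \<gamma> * r \<noteq> 0" using assms by simp
  have "4 * r * (\<gamma> / (1 - \<gamma> * r)\<^sup>2) + 1 = ((1 + \<gamma> * r) / (1 - \<gamma> * r))\<^sup>2"
    using ne by (simp add: power_divide divide_simps) (simp add: power2_eq_square algebra_simps)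
  then show ?thesis using assms by (simp add: real_sqrt_abs)
qed

text \<open>Without the root, the denominator is
  \<open>(1 + (\<gamma> * r)^2) / (1 - \<gamma> * r)^2\<close>, already positive; the root adds a
  nonnegative term.\<close>

lemma est2_denominator_pos:
  assumes "\<gamma> * r < 1"
  shows "2 * r * (\<gamma> / (1 - \<gamma> * r)\<^sup>2) + 1 + sqrt (4 * r * (\<gamma> / (1 - \<gamma> * r)\<^sup>2) + 1) > 0"
proof -
  have ne: "1 - \<gamma> * r \<noteq> 0" using assms by simp
  have "2 * r * (\<gamma> / (1 - \<gamma> * r)\<^sup>2) + 1 = (1 + (\<gamma> * r)\<^sup>2) / (1 - \<gamma> * r)\<^sup>2"
    using ne by (simp add: divide_simps) (simp add: power2_eq_square algebra_simps)
  also have "\<dots> > 0" using assms by (intro divide_pos_pos add_pos_nonneg) auto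
  finally show ?thesis using assms by (simp only: sqrt_limit_moment) (simp add: add_pos_nonneg)
qed

lemma est_at_limit:
  assumes "\<gamma> > 0" "r > 0" "\<gamma> * r < 1"
  shows "est l r (1 / (1 - \<gamma> * r)) (\<gamma> / (1 - \<gamma> * r)\<^sup>2) = \<gamma>"
proof -
  define d where "d = 1 - \<gamma> * r"
  have d: "d > 0" "d \<noteq> 0" using assms by (auto simp: d_def)
  have gr: "\<gamma> * r = 1 - d" by (simp add: d_def)
  have 1: "(1 / d - 1) / (r * (1 / d)) = \<gamma>"
  proof -
    have "(1 / d - 1) / (r * (1 / d)) = (1 - d) / r" using d assms by (simp add: field_simps)
    then show ?thesis using assms by (simp flip: gr)
  qed
  have 2: "2 * (\<gamma> / d\<^sup>2) / (2 * r * (\<gamma> / d\<^sup>2) + 1 + sqrt (4 * r * (\<gamma> / d\<^sup>2) + 1)) = \<gamma>"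
  proof -
    have "sqrt (4 * r * (\<gamma> / d\<^sup>2) + 1) = (2 - d) / d"
      using sqrt_limit_moment[OF assms(3)] assms by (simp add: d_def)
    moreover have "2 * r * (\<gamma> / d\<^sup>2) = 2 * (1 - d) / d\<^sup>2" using gr by (simp add: mult.commute)
    ultimately have "2 * r * (\<gamma> / d\<^sup>2) + 1 + sqrt (4 * r * (\<gamma> / d\<^sup>2) + 1) = 2 * (1 - d) / d\<^sup>2 + 1 + (2 - d) / d"
      by simp
    also have "\<dots> = 2 / d\<^sup>2" using d by (simp add: field_simps power2_eq_square)
    finally show ?thesis using d by simp
  qed
  have 3: "(r * (\<gamma> / d\<^sup>2) - 1 / d + 1) / (r\<^sup>2 * (\<gamma> / d\<^sup>2)) = \<gamma>"
  proof -
    have e: "r * (\<gamma> / d\<^sup>2) = (1 - d) / d\<^sup>2" "r\<^sup>2 * (\<gamma> / d\<^sup>2) = r * (1 - d) / d\<^sup>2"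
      using gr by (simp_all add: mult.commute power2_eq_square mult.left_commute)
    have e': "(1 - d) / d\<^sup>2 - 1 / d + 1 = (1 - d)\<^sup>2 / d\<^sup>2"
      using d by (simp add: field_simps power2_eq_square)
    have "1 - d > 0" using assms by (simp add: d_def)
    then have "(r * (\<gamma> / d\<^sup>2) - 1 / d + 1) / (r\<^sup>2 * (\<gamma> / d\<^sup>2)) = (1 - d) / r"
      unfolding e e' using d assms by (simp add: power2_eq_square)
    also have "(1 - d) / r = \<gamma>" using assms by (simp flip: gr)
    finally show ?thesis .
  qed
  show ?thesis using 1 2 3 unfolding est_def d_def by simp
qed

section \<open>Asymptotic bias\<close>

theorem theorem4:
  fixes M :: "'a measure" and X :: "nat \<Rightarrow> 'a \<Rightarrow> real"
    and \<gamma> r :: real and k :: "nat \<Rightarrow> nat"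
  assumes "prob_space M"
    and rv: "\<And>i. X i \<in> borel_measurable M"
    and indep: "prob_space.indep_vars M (\<lambda>_. borel) X UNIV"
    and ident: "\<And>i. distr M borel (X i) = distr M borel (X 0)"
    and nonneg: "\<And>i \<omega>. \<omega> \<in> space M \<Longrightarrow> X i \<omega> \<ge> 0"
    and gpos: "\<gamma> > 0"
    and regvar: "\<And>x. x > 0 \<Longrightarrow>
       ((\<lambda>t. gen_inv (\<lambda>y. measure M {\<omega>\<in>space M. X 0 \<omega> \<le> y}) (1 - 1 / (t * x))
           / gen_inv (\<lambda>y. measure M {\<omega>\<in>space M. X 0 \<omega> \<le> y}) (1 - 1 / t))
        \<longlongrightarrow> x powr \<gamma>) at_top"
    and gr: "\<gamma> * r < 1"
    and k_inf: "filterlim k at_top at_top"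
    and nk_inf: "filterlim (\<lambda>n. real n / real (k n)) at_top at_top"
    and j: "j \<in> {1, 2, 3::nat}"
  shows "xlim_conv_in_prob M (\<lambda>n \<omega> x. B_diff j X n (k n) r \<omega> x)
           (if r < 0 then 0 else if r = 0 then \<infinity> else ereal ((1 - \<gamma> * r) / r))"
proof -
  interpret prob_space M by fact
  interpret S: regvar_sample M X \<gamma> "\<lambda>n. n - 1" "\<lambda>n. k n - 1"
  proof unfold_locales
    show "filterlim (\<lambda>n. k n - 1) at_top sequentially"
      unfolding filterlim_at_top
    proof
      fix c
      have "eventually (\<lambda>n. k n \<ge> Suc c) sequentially" using k_inf by (simp add: filterlim_at_top)
      then show "eventually (\<lambda>n. c \<le> k n - 1) sequentially" by eventually_elim simp
    qed
    \<comment> \<open>For \<open>n\<close> at least 2, \<open>n - 1\<close> is at least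
      \<open>n / 2\<close>, so passing to \<open>n - 1\<close> and \<open>k n - 1\<close> costs at
      most a factor 2.\<close>
    have "filterlim (\<lambda>n. 1 / 2 * (real n / real (k n))) at_top sequentially"
      by (rule filterlim_tendsto_pos_mult_at_top[OF tendsto_const _ nk_inf]) simp
    moreover have "eventually (\<lambda>n. 1 / 2 * (real n / real (k n)) \<le> real (n - 1) / real (k n - 1)) sequentially"
    proof -
      have "eventually (\<lambda>n. k n \<ge> 2) sequentially" using k_inf by (simp add: filterlim_at_top)
      then show ?thesis using eventually_ge_at_top[of 2]
      proof eventually_elim
        case (elim n)
        then have "real n / 2 / real (k n) \<le> real (n - 1) / real (k n - 1)"
          by (intro frac_le) (auto simp: of_nat_diff)
        then show ?case by simp
      qed
    qed
    ultimately show "filterlim (\<lambda>n. real (n - 1) / real (k n - 1)) at_top sequentially"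
      by (rule filterlim_at_top_mono)
  qed (fact indep ident nonneg gpos regvar)+
  define xs where "xs p = map (\<lambda>i. X i (snd p)) [0..<fst p - 1]" for p :: "nat \<times> 'a"
  define H where "H u p = G_stat (k (fst p) - 1) r u (xs p)" for u and p :: "nat \<times> 'a"
  have xs: "S.xs (fst p) (snd p) = xs p" for p unfolding S.xs_def xs_def ..
  have D: "B_diff j X (fst p) (k (fst p)) r (snd p) x =
      gamma_hat j (k (fst p)) r (xs p @ [x]) - gamma_hat j (k (fst p) - 1) r (xs p)" for p x
    by (simp add: B_diff_def xs_def)
  have Z: "S.Z (fst p) (snd p) = ord_stat (xs p) (length (xs p) - (k (fst p) - 1))" for p
    unfolding S.Z_def xs by (simp add: xs_def)
  have out: "eventually (\<lambda>p. outlier (xs p) (k (fst p))) (whp M)"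
    using S.eventually_whp_k_m S.Z_pos_whp
  proof eventually_elim
    case (elim p)
    then show ?case unfolding Z outlier_def by (auto simp: xs_def)
  qed
  define c0 where "c0 = 1 / (1 - \<gamma> * r)"
  define c1 where "c1 = \<gamma> / (1 - \<gamma> * r)\<^sup>2"
  have c: "c0 \<noteq> 0" "c1 \<noteq> 0" "2 * r * c1 + 1 + sqrt (4 * r * c1 + 1) \<noteq> 0"
    using gr gpos est2_denominator_pos[OF gr] by (auto simp: c0_def c1_def)
  have H: "(H 0 \<longlongrightarrow> c0) (whp M)" "(H 1 \<longlongrightarrow> c1) (whp M)" if "r \<noteq> 0"
    using S.G_stat_0_whp[OF that gr, unfolded xs] S.G_stat_1_whp[OF that gr, unfolded xs]
    by (simp_all add: H_def[abs_def] c0_def c1_def)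
  consider "r < 0" | "r = 0" | "r > 0" by linarith
  then show ?thesis
  proof cases
    case 1
    then have r: "r \<noteq> 0" by simp
    define a where "a p = real (k (fst p) - 1) / real (k (fst p))" for p :: "nat \<times> 'a"
    have "((\<lambda>n. real (k n - 1) / real (k n)) \<longlonglongrightarrow> 1)"
    proof -
      have "(\<lambda>n. real (n - 1) / real n) \<longlonglongrightarrow> 1" by real_asymp
      from filterlim_compose[OF this k_inf] show ?thesis .
    qed
    from filterlim_compose[OF this filterlim_fst_whp]
    have a: "(a \<longlongrightarrow> 1) (whp M)" by (simp add: a_def[abs_def])
    have aH: "((\<lambda>p. a p * H 0 p) \<longlongrightarrow> c0) (whp M)" "((\<lambda>p. a p * H 1 p) \<longlongrightarrow> c1) (whp M)"
      using tendsto_mult[OF a H(1)[OF r]] tendsto_mult[OF a H(2)[OF r]] by simp_all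
    \<comment> \<open>Only equality of the two limits matters, not their value: for
      \<open>\<gamma> * r < -1\<close> and \<open>j = 2\<close> the common limit is
      \<open>1 / (\<gamma> * r^2)\<close> instead of \<open>\<gamma>\<close>.\<close>
    have "((\<lambda>p. est j r (a p * H 0 p) (a p * H 1 p) - est j r (H 0 p) (H 1 p)) \<longlongrightarrow>
        est j r c0 c1 - est j r c0 c1) (whp M)"
      by (intro tendsto_diff tendsto_est r c aH H)
    then have L: "((\<lambda>p. ereal (est j r (a p * H 0 p) (a p * H 1 p) - est j r (H 0 p) (H 1 p))) \<longlongrightarrow> 0) (whp M)"
      by (simp add: zero_ereal_def)
    \<comment> \<open>The inner limit in \<open>x\<close> needs continuity of \<open>est\<close> at
      the random pair \<open>(a p * H 0 p, a p * H 1 p)\<close>. Its nonvanishing conditions are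
      inherited from \<open>c0\<close> and \<open>c1\<close> with probability tending to 1.\<close>
    have "((\<lambda>p. 2 * r * (a p * H 1 p) + 1 + sqrt (4 * r * (a p * H 1 p) + 1)) \<longlongrightarrow>
        2 * r * c1 + 1 + sqrt (4 * r * c1 + 1)) (whp M)"
      by (intro tendsto_intros aH)
    from tendsto_imp_eventually_ne[OF this c(3)] tendsto_imp_eventually_ne[OF aH(1) c(1)]
      tendsto_imp_eventually_ne[OF aH(2) c(2)] out
    have "eventually (\<lambda>p. ((\<lambda>x. ereal (B_diff j X (fst p) (k (fst p)) r (snd p) x)) \<longlongrightarrow>
        ereal (est j r (a p * H 0 p) (a p * H 1 p) - est j r (H 0 p) (H 1 p))) at_top) (whp M)"
    proof eventually_elim
      case (elim p)
      interpret outlier "xs p" "k (fst p)" by fact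
      have "((\<lambda>x. est j r (G_stat (k (fst p)) r 0 (xs p @ [x])) (G_stat (k (fst p)) r 1 (xs p @ [x]))) \<longlongrightarrow>
          est j r (a p * H 0 p) (a p * H 1 p)) at_top"
        using G_tendsto_neg[OF 1, of 0] G_tendsto_neg[OF 1, of 1] elim
        by (intro tendsto_est r) (simp_all add: a_def H_def)
      then show ?case
        unfolding D gamma_hat_eq_est[OF r] H_def by (intro tendsto_ereal tendsto_diff tendsto_const)
    qed
    from xlim_conv_in_probI[OF L this] show ?thesis using 1 by simp
  next
    case 2
    from out have "eventually (\<lambda>p. ((\<lambda>x. ereal (B_diff j X (fst p) (k (fst p)) r (snd p) x)) \<longlongrightarrow> \<infinity>) at_top) (whp M)"
    proof eventually_elim
      case (elim p)
      interpret outlier "xs p" "k (fst p)" by fact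
      have "filterlim (\<lambda>x. - gamma_hat j (k (fst p) - 1) r (xs p) + gamma_hat j (k (fst p)) r (xs p @ [x])) at_top at_top"
        unfolding 2 by (rule filterlim_tendsto_add_at_top[OF tendsto_const gamma_hat_0_at_top])
      then show ?case by (simp add: D tendsto_PInfty_eq_at_top)
    qed
    from xlim_conv_in_probI[OF tendsto_const this] show ?thesis using 2 by simp
  next
    case 3
    then have r: "r \<noteq> 0" by simp
    \<comment> \<open>The outlier drives the first estimator to exactly \<open>1 / r\<close>; the
      randomness left is in the second, which is consistent for \<open>\<gamma>\<close>.\<close>
    have "((\<lambda>p. 1 / r - est j r (H 0 p) (H 1 p)) \<longlongrightarrow> 1 / r - est j r c0 c1) (whp M)"
      by (intro tendsto_diff tendsto_const tendsto_est r c H)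
    moreover have "1 / r - est j r c0 c1 = (1 - \<gamma> * r) / r"
      unfolding c0_def c1_def est_at_limit[OF gpos 3 gr] using r by (simp add: field_simps)
    ultimately have L: "((\<lambda>p. ereal (1 / r - est j r (H 0 p) (H 1 p))) \<longlongrightarrow> ereal ((1 - \<gamma> * r) / r)) (whp M)"
      by simp
    from out have "eventually (\<lambda>p. ((\<lambda>x. ereal (B_diff j X (fst p) (k (fst p)) r (snd p) x)) \<longlongrightarrow>
        ereal (1 / r - est j r (H 0 p) (H 1 p))) at_top) (whp M)"
    proof eventually_elim
      case (elim p)
      interpret outlier "xs p" "k (fst p)" by fact
      show ?case
        unfolding D gamma_hat_eq_est[OF r, of _ "k (fst p) - 1"] H_def
        by (intro tendsto_ereal tendsto_diff tendsto_const gamma_hat_pos_tendsto 3)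
    qed
    from xlim_conv_in_probI[OF L this] show ?thesis using 3 by simp
  qed
qed

end
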